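(* Let $R$ be a positive number and $f\colon[-1,1]^2\to\mathbb{R}$ a smooth function such that $F_{R,f}\equiv0$. Then $\Phi_{R,f}^{-1}(0,0)$ is a stem in $(S^2\times S^2,\omega_R)$; in particular, it is $\zeta$-superheavy for any partial symplectic quasi-state $\zeta$ on $(S^2\times S^2,\omega_R)$.
   Context: $S^2=\{(x,y,z)\in\mathbb{R}^3\mid x^2+y^2+z^2=1\}$ with its standard symplectic form $\omega_{S^2}$, and, for $R>0$, $\omega_R=\mathrm{pr}_1^\ast\omega_{S^2}+R\,\mathrm{pr}_2^\ast\omega_{S^2}$ on $S^2\times S^2$, where $\mathrm{pr}_1,\mathrm{pr}_2$ are the first and second projections. For a smooth $f\colon[-1,1]^2\to\mathbb{R}$ define on $S^2\times S^2$ $$J_R(x_1,y_1,z_1,x_2,y_2,z_2)=z_1+Rz_2,$$ $$H_f(x_1,y_1,z_1,x_2,y_2,z_2)=x_1x_2+y_1y_2+z_1z_2-f(z_1,z_2),$$ and $\Phi_{R,f}=(J_R,H_f)\colon S^2\times S^2\to\mathbb{R}^2$; the functions $J_R$ and $H_f$ Poisson-commute on $(S^2\times S^2,\omega_R)$, and $\Phi_{R,f}$ is regarded as the moment map of the subspace they span. Define $$F_{R,f}(z)=-\tfrac12\bigl(f(-Rz,z)+f(Rz,-z)+2Rz^2\bigr)$$ for $z\in[-1,1]$ with $|Rz|\le1$. Let $(M,\omega)$ be a closed symplectic manifold. $C(M)$ (resp. $C^\infty(M)$) is the set of continuous (resp. smooth) real-valued functions on $M$. A subspace $\mathbb{A}\subset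 C^\infty(M)$ is Poisson-commutative if $\{F,G\}=0$ for all $F,G\in\mathbb{A}$; if $\mathbb{A}$ is finite-dimensional, its moment map $\Phi\colon M\to\mathbb{A}^\ast$ is given by $F(x)=\langle\Phi(x),F\rangle$. For a (smooth) Hamiltonian $H\colon S^1\times M\to\mathbb{R}$ ($H_t=H(t,\cdot)$), the Hamiltonian vector field is defined by $\iota_{X_{H_t}}\omega=-dH_t$, and $\varphi_H$ is the time-1 map of its flow; $\mathrm{Ham}(M,\omega)$ is the group of all such $\varphi_H$. A subset $X\subset M$ is displaceable from $Y\subset M$ if there is $H$ with $\varphi_H(X)\cap\overline{Y}=\emptyset$. A closed subset $X\subset M$ is a stem if there exists a finite-dimensional Poisson-commutative subspace $\mathbb{A}$ of $C^\infty(M)$, with moment map $\Phi$, such that (1) $X=\Phi^{-1}(p)$ for some $p\in\Phi(M)$, and (2) every non-trivial (i.e. non-empty) fiber of $\Phi$ other than $X$ is displaceable from itself. A partial symplectic quasi-state on $(M,\omega)$ is a functional $\zeta\colon C(M)\to\mathbb{R}$ such that: (Normalization) $\zeta(a)=a$ for every constant function $a$; (Stability) $\min_M(H_1-H_2)\le\zeta(H_1)-\zeta(H_2)\le\max_M(H_1-H_2)$ for all $H_1,H_2\in C(M)$; (Semi-homogeneity) $\zeta(sH)=s\zeta(H)$ for all $H\in C(M)$, $s>0$; (Hamiltonian invariance) $\zeta(H\circ\phi)=\zeta(H)$ for all $H\in C(M)$, $\phi\in\mathrm{Ham}(M,\omega)$; (Vanishing) $\zeta(H)=0$ for every $H\in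 C(M)$ whose support is displaceable from itself; (Quasi-subadditivity) $\zeta(H_1+H_2)\le\zeta(H_1)+\zeta(H_2)$ for all $H_1,H_2\in C^\infty(M)$ with $\{H_1,H_2\}=0$. A closed subset $X\subset M$ is $\zeta$-superheavy if $\zeta(H)\le\sup_X H$ for every $H\in C(M)$. *)

theory Defs
  imports "HOL-Analysis.Analysis" "HOL-Library.Function_Algebras"
begin

text \<open>
  Pointwise real vector space structure on functions, so that the library's \<open>subspace\<close> and
  \<open>span\<close> apply to spaces of functions.
\<close>

instantiation "fun" :: (type, real_vector) real_vector
begin

definition scaleR_fun_def: "scaleR c f = (\<lambda>x. c *\<^sub>R f x)"

instance
  by standard (auto simp: scaleR_fun_def fun_eq_iff scaleR_add_right scaleR_add_left)

end


section \<open>Smooth maps\<close>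

text \<open>Class $C^k$ on an open set.\<close>

primrec Ck_on :: "nat \<Rightarrow> 'a::euclidean_space set \<Rightarrow> ('a \<Rightarrow> 'b::real_normed_vector) \<Rightarrow> bool" where
  "Ck_on 0 U f \<longleftrightarrow> continuous_on U f"
| "Ck_on (Suc k) U f \<longleftrightarrow>
     (\<forall>x\<in>U. f differentiable (at x)) \<and> (\<forall>v. Ck_on k U (\<lambda>x. frechet_derivative f (at x) v))"

text \<open>A map on an arbitrary subset \<open>X\<close> is smooth if it extends to a smooth map on an open
  neighbourhood of \<open>X\<close>. For an embedded submanifold this is smoothness in the intrinsic sense, and
  for the square \<open>[-1,1]\<^sup>2\<close> it is smoothness up to the boundary.\<close>

definition smooth_on :: "'a::euclidean_space set \<Rightarrow> ('a \<Rightarrow> 'b::real_normed_vector) \<Rightarrow> bool" where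
  "smooth_on X f \<longleftrightarrow>
     (\<exists>U g. open U \<and> X \<subseteq> U \<and> (\<forall>k. Ck_on k U g) \<and> (\<forall>x\<in>X. g x = f x))"


section \<open>Symplectic geometry\<close>

text \<open>
  A closed symplectic manifold \<open>(M, \<omega>)\<close> is represented by a compact smoothly embedded submanifold
  \<open>M\<close> of a Euclidean space together with \<open>\<omega>\<close>, where \<open>\<omega> p u v\<close> is the value of the form at \<open>p \<in> M\<close>
  on tangent vectors \<open>u\<close>, \<open>v\<close>; its values at other arguments are irrelevant. Functions on \<open>M\<close> are
  represented by total functions, of which only the values on \<open>M\<close> matter.
\<close>

type_synonym 'a form2 = "'a \<Rightarrow> 'a \<Rightarrow> 'a \<Rightarrow> real"

definition smooth_functions :: "'a::euclidean_space set \<Rightarrow> ('a \<Rightarrow> real) set" where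
  "smooth_functions M = {F. smooth_on M F}"

definition continuous_functions :: "'a::euclidean_space set \<Rightarrow> ('a \<Rightarrow> real) set" where
  "continuous_functions M = {F. continuous_on M F}"

definition curve_with_velocity :: "'a::euclidean_space set \<Rightarrow> 'a \<Rightarrow> 'a \<Rightarrow> (real \<Rightarrow> 'a) \<Rightarrow> bool" where
  "curve_with_velocity M p v \<gamma> \<longleftrightarrow>
     (\<exists>e>0. smooth_on {-e<..<e} \<gamma> \<and> \<gamma> ` {-e<..<e} \<subseteq> M) \<and>
     \<gamma> 0 = p \<and> (\<gamma> has_vector_derivative v) (at 0)"

definition tangent_space :: "'a::euclidean_space set \<Rightarrow> 'a \<Rightarrow> 'a set" where
  "tangent_space M p = {v. \<exists>\<gamma>. curve_with_velocity M p v \<gamma>}"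

text \<open>\<open>differential M F p v\<close> is $dF_p(v)$, for \<open>v\<close> tangent to \<open>M\<close> at \<open>p\<close>.\<close>

definition differential :: "'a::euclidean_space set \<Rightarrow> ('a \<Rightarrow> real) \<Rightarrow> 'a \<Rightarrow> 'a \<Rightarrow> real" where
  "differential M F p v =
     (THE d. \<forall>\<gamma>. curve_with_velocity M p v \<gamma> \<longrightarrow>
               ((\<lambda>t. F (\<gamma> t)) has_real_derivative d) (at 0))"

text \<open>The convention is \<open>\<iota>\<^bsub>X\<^esub> \<omega> = - dF\<close>.\<close>

definition hamiltonian_vector_field ::
  "'a::euclidean_space set \<Rightarrow> 'a form2 \<Rightarrow> ('a \<Rightarrow> real) \<Rightarrow> 'a \<Rightarrow> 'a" where
  "hamiltonian_vector_field M \<omega> F p =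
     (THE v. v \<in> tangent_space M p \<and> (\<forall>w\<in>tangent_space M p. \<omega> p v w = - differential M F p w))"

text \<open>The sign convention for the bracket is immaterial, since only its vanishing is used.\<close>

definition poisson_bracket ::
  "'a::euclidean_space set \<Rightarrow> 'a form2 \<Rightarrow> ('a \<Rightarrow> real) \<Rightarrow> ('a \<Rightarrow> real) \<Rightarrow> 'a \<Rightarrow> real" where
  "poisson_bracket M \<omega> F G p =
     \<omega> p (hamiltonian_vector_field M \<omega> G p) (hamiltonian_vector_field M \<omega> F p)"

definition poisson_commute ::
  "'a::euclidean_space set \<Rightarrow> 'a form2 \<Rightarrow> ('a \<Rightarrow> real) \<Rightarrow> ('a \<Rightarrow> real) \<Rightarrow> bool" where
  "poisson_commute M \<omega> F G \<longleftrightarrow> (\<forall>p\<in>M. poisson_bracket M \<omega> F G p = 0)"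

text \<open>Smooth functions on \<open>S\<^sup>1 \<times> M\<close>, with \<open>S\<^sup>1 = \<real> / \<int>\<close>, are smooth functions on \<open>\<real> \<times> M\<close> that are
  1-periodic in the first variable.\<close>

definition time_dependent_hamiltonian ::
  "'a::euclidean_space set \<Rightarrow> (real \<Rightarrow> 'a \<Rightarrow> real) \<Rightarrow> bool" where
  "time_dependent_hamiltonian M H \<longleftrightarrow>
     smooth_on (UNIV \<times> M) (\<lambda>(t, x). H t x) \<and> (\<forall>t. \<forall>x\<in>M. H (t + 1) x = H t x)"

text \<open>\<open>\<phi>\<close> agrees on \<open>M\<close> with the time-1 map of the flow of the vector fields \<open>X\<^bsub>H t\<^esub>\<close>.\<close>

definition is_time1_map ::
  "'a::euclidean_space set \<Rightarrow> 'a form2 \<Rightarrow> (real \<Rightarrow> 'a \<Rightarrow> real) \<Rightarrow> ('a \<Rightarrow> 'a) \<Rightarrow> bool" where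
  "is_time1_map M \<omega> H \<phi> \<longleftrightarrow>
     (\<exists>\<psi> :: real \<Rightarrow> 'a \<Rightarrow> 'a.
        (\<forall>x\<in>M. \<psi> 0 x = x \<and> \<psi> 1 x = \<phi> x \<and>
           (\<forall>t. \<psi> t x \<in> M \<and>
              ((\<lambda>s. \<psi> s x) has_vector_derivative
                 hamiltonian_vector_field M \<omega> (H t) (\<psi> t x)) (at t))))"

definition Ham :: "'a::euclidean_space set \<Rightarrow> 'a form2 \<Rightarrow> ('a \<Rightarrow> 'a) set" where
  "Ham M \<omega> = {\<phi>. \<exists>H. time_dependent_hamiltonian M H \<and> is_time1_map M \<omega> H \<phi>}"

definition displaceable_from ::
  "'a::euclidean_space set \<Rightarrow> 'a form2 \<Rightarrow> 'a set \<Rightarrow> 'a set \<Rightarrow> bool" where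
  "displaceable_from M \<omega> X Y \<longleftrightarrow> (\<exists>\<phi>\<in>Ham M \<omega>. \<phi> ` X \<inter> closure Y = {})"


section \<open>Stems\<close>

text \<open>The moment map of \<open>A\<close> takes values in the dual of \<open>A\<close>; a linear functional on \<open>A\<close> is
  represented by its extensional restriction to \<open>A\<close>.\<close>

definition moment_map :: "('a \<Rightarrow> real) set \<Rightarrow> 'a \<Rightarrow> ('a \<Rightarrow> real) \<Rightarrow> real" where
  "moment_map A x = (\<lambda>F\<in>A. F x)"

definition fiber :: "'a set \<Rightarrow> ('a \<Rightarrow> 'b) \<Rightarrow> 'b \<Rightarrow> 'a set" where
  "fiber M \<Phi> p = {x \<in> M. \<Phi> x = p}"

definition poisson_commutative_subspace ::
  "'a::euclidean_space set \<Rightarrow> 'a form2 \<Rightarrow> ('a \<Rightarrow> real) set \<Rightarrow> bool" where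
  "poisson_commutative_subspace M \<omega> A \<longleftrightarrow>
     A \<subseteq> smooth_functions M \<and> subspace A \<and> (\<forall>F\<in>A. \<forall>G\<in>A. poisson_commute M \<omega> F G)"

definition finite_dimensional :: "'v::real_vector set \<Rightarrow> bool" where
  "finite_dimensional A \<longleftrightarrow> (\<exists>B. finite B \<and> A = span B)"

definition stem :: "'a::euclidean_space set \<Rightarrow> 'a form2 \<Rightarrow> 'a set \<Rightarrow> bool" where
  "stem M \<omega> X \<longleftrightarrow>
     closedin (top_of_set M) X \<and>
     (\<exists>A. poisson_commutative_subspace M \<omega> A \<and> finite_dimensional A \<and>
        (\<exists>p \<in> moment_map A ` M. X = fiber M (moment_map A) p) \<and>
        (\<forall>q. fiber M (moment_map A) q \<noteq> {} \<and> fiber M (moment_map A) q \<noteq> X \<longrightarrow>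
             displaceable_from M \<omega> (fiber M (moment_map A) q) (fiber M (moment_map A) q)))"


section \<open>Partial symplectic quasi-states\<close>

definition supp :: "'a::euclidean_space set \<Rightarrow> ('a \<Rightarrow> real) \<Rightarrow> 'a set" where
  "supp M H = M \<inter> closure {x \<in> M. H x \<noteq> 0}"

text \<open>A functional on the continuous functions on \<open>M\<close> is given as a functional on total functions,
  constrained only on \<open>continuous_functions M\<close>. Stability forces the value to depend only on the
  restriction of the argument to \<open>M\<close>.\<close>

definition partial_symplectic_quasi_state ::
  "'a::euclidean_space set \<Rightarrow> 'a form2 \<Rightarrow> (('a \<Rightarrow> real) \<Rightarrow> real) \<Rightarrow> bool" where
  "partial_symplectic_quasi_state M \<omega> \<zeta> \<longleftrightarrow>
     \<comment> \<open>normalization\<close>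
     (\<forall>a. \<zeta> (\<lambda>_. a) = a) \<and>
     \<comment> \<open>stability; the extrema are attained since \<open>M\<close> is compact\<close>
     (\<forall>H1\<in>continuous_functions M. \<forall>H2\<in>continuous_functions M.
        (INF x\<in>M. H1 x - H2 x) \<le> \<zeta> H1 - \<zeta> H2 \<and> \<zeta> H1 - \<zeta> H2 \<le> (SUP x\<in>M. H1 x - H2 x)) \<and>
     \<comment> \<open>semi-homogeneity\<close>
     (\<forall>H\<in>continuous_functions M. \<forall>s>0. \<zeta> (\<lambda>x. s * H x) = s * \<zeta> H) \<and>
     \<comment> \<open>Hamiltonian invariance\<close>
     (\<forall>H\<in>continuous_functions M. \<forall>\<phi>\<in>Ham M \<omega>. \<zeta> (H \<circ> \<phi>) = \<zeta> H) \<and>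
     \<comment> \<open>vanishing\<close>
     (\<forall>H\<in>continuous_functions M. displaceable_from M \<omega> (supp M H) (supp M H) \<longrightarrow> \<zeta> H = 0) \<and>
     \<comment> \<open>quasi-subadditivity\<close>
     (\<forall>H1\<in>smooth_functions M. \<forall>H2\<in>smooth_functions M.
        poisson_commute M \<omega> H1 H2 \<longrightarrow> \<zeta> (\<lambda>x. H1 x + H2 x) \<le> \<zeta> H1 + \<zeta> H2)"

text \<open>The supremum is taken in the extended reals, so that it is \<open>-\<infinity>\<close> for empty \<open>X\<close>.\<close>

definition superheavy ::
  "'a::euclidean_space set \<Rightarrow> (('a \<Rightarrow> real) \<Rightarrow> real) \<Rightarrow> 'a set \<Rightarrow> bool" where
  "superheavy M \<zeta> X \<longleftrightarrow>
     closedin (top_of_set M) X \<and>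
     (\<forall>H\<in>continuous_functions M. ereal (\<zeta> H) \<le> (SUP x\<in>X. ereal (H x)))"


section \<open>The systems on the product of two spheres\<close>

abbreviation S2 :: "(real^3) set" where
  "S2 \<equiv> sphere 0 1"

text \<open>The standard area form of the unit sphere, $\det(p, u, v)$.\<close>

definition omega_S2 :: "(real^3) form2" where
  "omega_S2 p u v = p \<bullet> cross3 u v"

definition omega :: "real \<Rightarrow> ((real^3) \<times> (real^3)) form2" where
  "omega R p u v = omega_S2 (fst p) (fst u) (fst v) + R * omega_S2 (snd p) (snd u) (snd v)"

definition J_fun :: "real \<Rightarrow> (real^3) \<times> (real^3) \<Rightarrow> real" where
  "J_fun R = (\<lambda>(a, b). a $ 3 + R * b $ 3)"

definition H_fun :: "(real \<times> real \<Rightarrow> real) \<Rightarrow> (real^3) \<times> (real^3) \<Rightarrow> real" where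
  "H_fun f = (\<lambda>(a, b). a $ 1 * b $ 1 + a $ 2 * b $ 2 + a $ 3 * b $ 3 - f (a $ 3, b $ 3))"

definition Phi :: "real \<Rightarrow> (real \<times> real \<Rightarrow> real) \<Rightarrow> (real^3) \<times> (real^3) \<Rightarrow> real \<times> real" where
  "Phi R f x = (J_fun R x, H_fun f x)"

definition F_fun :: "real \<Rightarrow> (real \<times> real \<Rightarrow> real) \<Rightarrow> real \<Rightarrow> real" where
  "F_fun R f z = - (1 / 2) * (f (- R * z, z) + f (R * z, - z) + 2 * R * z\<^sup>2)"

end

theory Submission
  imports Defs
begin

text \<open>
  Everything rests on one symmetry. Let \<open>\<phi>\<close> be the half turn about the first axis on the first sphere
  and the half turn about the second axis on the second sphere; it is the time-1 map of the function
  $\pi (x_1 + R y_2)$. It reverses both heights, so \<open>J \<circ> \<phi> = - J\<close>, and it changes the sign of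
  $x_1 x_2 + y_1 y_2$. On \<open>J = 0\<close> one has $z_1 = - R z_2$, and there \<open>F = 0\<close> says exactly that
  $z_1 z_2 - f(z_1, z_2)$ is an odd function of $z_2$; hence \<open>H \<circ> \<phi> = - H\<close> on \<open>J = 0\<close>
  (\<open>H_fun_half_turns\<close>). So \<open>\<phi>\<close> displaces every fibre of \<open>(J, H)\<close> except the one over the origin: a
  fibre with \<open>J \<noteq> 0\<close> goes to the opposite value of \<open>J\<close>, and a fibre with \<open>J = 0\<close>, \<open>H \<noteq> 0\<close> goes to
  the opposite value of \<open>H\<close>. As \<open>J\<close> and \<open>H\<close> Poisson-commute, the fibre over the origin is a stem.

  For superheaviness, let \<open>G\<close> be continuous with \<open>G < c\<close> on this fibre. By compactness \<open>G < c\<close> wherever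
  both \<open>J\<close> and \<open>H\<close> are small, so \<open>G\<close> is at most \<open>c\<close> plus four nonnegative continuous functions of
  \<open>(J, H)\<close>, supported respectively where \<open>J\<close> is positive, where \<open>J\<close> is negative, and, for \<open>J\<close> close
  to \<open>0\<close>, where \<open>H\<close> is positive and where \<open>H\<close> is negative. The map \<open>\<phi>\<close> displaces each of the four
  supports, so a quasi-state \<open>\<zeta>\<close> vanishes on each summand, and subadditivity gives \<open>\<zeta> G \<le> c\<close>.
  Quasi-subadditivity speaks of smooth commuting functions only; it extends to continuous functions of
  \<open>(J, H)\<close> because \<open>\<zeta>\<close> is continuous in the uniform norm and polynomials in \<open>J\<close> and \<open>H\<close>, which are
  smooth and commute, are dense among them (\<open>quasi_state_subadditive_joint\<close>).
\<close>

section \<open>Calculus of smooth functions\<close>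

lemma Ck_on_SucD:
  assumes "Ck_on (Suc k) U f" "x \<in> U"
  shows "(f has_derivative frechet_derivative f (at x)) (at x)"
  using assms frechet_derivative_works by auto

lemma Ck_on_cong:
  assumes "open U" "\<And>x. x \<in> U \<Longrightarrow> f x = g x" "Ck_on k U f"
  shows "Ck_on k U g"
  using assms(2,3)
proof (induction k arbitrary: f g)
  case 0
  then show ?case by (simp cong: continuous_on_cong)
next
  case (Suc k)
  have D: "(g has_derivative frechet_derivative f (at x)) (at x)" if "x \<in> U" for x
    using Ck_on_SucD[OF Suc.prems(2) that] assms(1) that Suc.prems(1)
    by (rule has_derivative_transform_within_open)
  have eq: "frechet_derivative f (at x) = frechet_derivative g (at x)" if "x \<in> U" for x
    by (rule frechet_derivative_at[OF D[OF that]])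
  have "Ck_on k U (\<lambda>x. frechet_derivative g (at x) v)" for v
  proof (rule Suc.IH[of "\<lambda>x. frechet_derivative f (at x) v"])
    show "Ck_on k U (\<lambda>x. frechet_derivative f (at x) v)"
      using Suc.prems(2) by simp
  qed (simp add: eq)
  then show ?case
    using D by (auto simp: differentiable_def)
qed

lemma Ck_on_SucI:
  assumes "open U" "\<And>x. x \<in> U \<Longrightarrow> (f has_derivative D x) (at x)" "\<And>v. Ck_on k U (\<lambda>x. D x v)"
  shows "Ck_on (Suc k) U f"
proof -
  have "frechet_derivative f (at x) = D x" if "x \<in> U" for x
    using frechet_derivative_at[OF assms(2)[OF that]] by simp
  then have "Ck_on k U (\<lambda>x. frechet_derivative f (at x) v)" for v
    by (intro Ck_on_cong[OF assms(1) _ assms(3)]) simp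
  then show ?thesis
    using assms(2) by (auto simp: differentiable_def)
qed

lemma Ck_on_subset:
  assumes "Ck_on k U f" "V \<subseteq> U"
  shows "Ck_on k V f"
  using assms by (induction k arbitrary: f) (auto intro: continuous_on_subset)

lemma Ck_on_SucD_same:
  assumes "Ck_on (Suc k) U f"
  shows "Ck_on k U f"
  using assms
proof (induction k arbitrary: f)
  case 0
  then show ?case
    by (auto simp: differentiable_imp_continuous_within intro!: continuous_at_imp_continuous_on)
next
  case (Suc k)
  then show ?case by (metis Ck_on.simps(2))
qed

lemma Ck_on_const: "open U \<Longrightarrow> Ck_on k U (\<lambda>_. c)"
proof (induction k arbitrary: c)
  case (Suc k)
  then show ?case
    by (intro Ck_on_SucI[where D = "\<lambda>_ _. 0"]) auto
qed simp

lemma Ck_on_linear: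
  assumes "open U" "bounded_linear L"
  shows "Ck_on k U L"
proof (cases k)
  case 0
  then show ?thesis using assms linear_continuous_on by auto
next
  case (Suc n)
  have "Ck_on (Suc n) U L"
    by (rule Ck_on_SucI[where D = "\<lambda>_. L"])
       (use assms Ck_on_const bounded_linear_imp_has_derivative in auto)
  with Suc show ?thesis by simp
qed

lemma Ck_on_add:
  assumes "open U" "Ck_on k U f" "Ck_on k U g"
  shows "Ck_on k U (\<lambda>x. f x + g x)"
  using assms(2,3)
proof (induction k arbitrary: f g)
  case 0
  then show ?case by (auto intro: continuous_intros)
next
  case (Suc k)
  show ?case
  proof (rule Ck_on_SucI)
    show "((\<lambda>x. f x + g x) has_derivative
        (\<lambda>v. frechet_derivative f (at x) v + frechet_derivative g (at x) v)) (at x)"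
      if "x \<in> U" for x
      using Suc.prems that by (intro has_derivative_add Ck_on_SucD)
  qed (use assms(1) Suc in auto)
qed

lemma Ck_on_mult:
  fixes f g :: "'a::euclidean_space \<Rightarrow> real"
  assumes "open U" "Ck_on k U f" "Ck_on k U g"
  shows "Ck_on k U (\<lambda>x. f x * g x)"
  using assms(2,3)
proof (induction k arbitrary: f g)
  case 0
  then show ?case by (auto intro: continuous_intros)
next
  case (Suc k)
  show ?case
  proof (rule Ck_on_SucI)
    show "((\<lambda>x. f x * g x) has_derivative
        (\<lambda>v. f x * frechet_derivative g (at x) v + frechet_derivative f (at x) v * g x)) (at x)"
      if "x \<in> U" for x
      using Suc.prems that by (intro has_derivative_mult Ck_on_SucD)
    show "Ck_on k U (\<lambda>x. f x * frechet_derivative g (at x) v + frechet_derivative f (at x) v * g x)" for v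
      using Suc.prems Ck_on_SucD_same
      by (intro Ck_on_add[OF assms(1)] Suc.IH) auto
  qed (use assms(1) in auto)
qed

lemma Ck_on_compose_linear:
  assumes "bounded_linear L" "open V" "Ck_on k V f"
  shows "Ck_on k (L -` V) (\<lambda>x. f (L x))"
  using assms(3)
proof (induction k arbitrary: f)
  case 0
  have "continuous_on (L -` V) L"
    using assms(1) linear_continuous_on by blast
  with 0 show ?case
    by (auto intro: continuous_on_compose2)
next
  case (Suc k)
  have op: "open (L -` V)"
    using assms(1,2) by (simp add: linear_continuous_on open_vimage)
  show ?case
  proof (rule Ck_on_SucI[OF op])
    show "((\<lambda>x. f (L x)) has_derivative (\<lambda>v. frechet_derivative f (at (L x)) (L v))) (at x)"
      if "x \<in> L -` V" for x
      using that Suc.prems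
      by (intro has_derivative_compose[OF bounded_linear_imp_has_derivative[OF assms(1)]] Ck_on_SucD) auto
  qed (use Suc in auto)
qed

text \<open>
  The induction on \<open>k\<close> closes because a derivative of such a curve has the same form with other
  coefficient vectors.
\<close>

lemma Ck_on_trig: "Ck_on k UNIV (\<lambda>t::real. cos (c * t) *\<^sub>R a + sin (c * t) *\<^sub>R b)"
proof (induction k arbitrary: a b)
  case 0
  then show ?case by (auto intro!: continuous_intros)
next
  case (Suc k)
  show ?case
  proof (rule Ck_on_SucI)
    show "((\<lambda>t. cos (c * t) *\<^sub>R a + sin (c * t) *\<^sub>R b) has_derivative
        (\<lambda>v. cos (c * t) *\<^sub>R ((v * c) *\<^sub>R b) + sin (c * t) *\<^sub>R (- (v * c) *\<^sub>R a))) (at t)" for t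
      by (auto intro!: derivative_eq_intros simp: algebra_simps fun_eq_iff)
    show "Ck_on k UNIV (\<lambda>t. cos (c * t) *\<^sub>R ((v * c) *\<^sub>R b) + sin (c * t) *\<^sub>R (- (v * c) *\<^sub>R a))" for v
      by (rule Suc.IH)
  qed simp
qed

lemma smooth_onE:
  assumes "smooth_on X f"
  obtains U g where "open U" "X \<subseteq> U" "\<And>k. Ck_on k U g" "\<And>x. x \<in> X \<Longrightarrow> g x = f x"
  using assms unfolding smooth_on_def by blast

lemma smooth_on_linear: "bounded_linear L \<Longrightarrow> smooth_on X L"
  unfolding smooth_on_def using Ck_on_linear open_UNIV subset_UNIV by blast

lemma smooth_on_const: "smooth_on X (\<lambda>_. c)"
  unfolding smooth_on_def using Ck_on_const open_UNIV subset_UNIV by blast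

lemma smooth_on_add:
  assumes "smooth_on X f" "smooth_on X g"
  shows "smooth_on X (\<lambda>x. f x + g x)"
proof -
  from assms obtain U F V G where
    "open U" "X \<subseteq> U" "\<And>k. Ck_on k U F" "\<And>x. x \<in> X \<Longrightarrow> F x = f x"
    "open V" "X \<subseteq> V" "\<And>k. Ck_on k V G" "\<And>x. x \<in> X \<Longrightarrow> G x = g x"
    by (metis smooth_onE)
  then show ?thesis
    unfolding smooth_on_def
    by (intro exI[of _ "U \<inter> V"] exI[of _ "\<lambda>x. F x + G x"])
       (auto intro!: Ck_on_add intro: Ck_on_subset[of _ U F] Ck_on_subset[of _ V G])
qed

lemma smooth_on_mult:
  fixes f g :: "'a::euclidean_space \<Rightarrow> real"
  assumes "smooth_on X f" "smooth_on X g"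
  shows "smooth_on X (\<lambda>x. f x * g x)"
proof -
  from assms obtain U F V G where
    "open U" "X \<subseteq> U" "\<And>k. Ck_on k U F" "\<And>x. x \<in> X \<Longrightarrow> F x = f x"
    "open V" "X \<subseteq> V" "\<And>k. Ck_on k V G" "\<And>x. x \<in> X \<Longrightarrow> G x = g x"
    by (metis smooth_onE)
  then show ?thesis
    unfolding smooth_on_def
    by (intro exI[of _ "U \<inter> V"] exI[of _ "\<lambda>x. F x * G x"])
       (auto intro!: Ck_on_mult intro: Ck_on_subset[of _ U F] Ck_on_subset[of _ V G])
qed

lemma smooth_on_compose_linear:
  assumes "bounded_linear L" "smooth_on Y f" "L ` X \<subseteq> Y"
  shows "smooth_on X (\<lambda>x. f (L x))"
proof -
  from assms(2) obtain V g where V: "open V" "Y \<subseteq> V" "\<And>k. Ck_on k V g" "\<And>y. y \<in> Y \<Longrightarrow> g y = f y"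
    by (metis smooth_onE)
  have "open (L -` V)"
    using assms(1) V(1) by (simp add: linear_continuous_on open_vimage)
  then show ?thesis
    unfolding smooth_on_def using V assms
    by (intro exI[of _ "L -` V"] exI[of _ "\<lambda>x. g (L x)"])
       (auto intro!: Ck_on_compose_linear, blast+)
qed

lemma smooth_on_imp_continuous_on:
  assumes "smooth_on X f"
  shows "continuous_on X f"
proof -
  from assms obtain U g where "X \<subseteq> U" "Ck_on 0 U g" "\<And>x. x \<in> X \<Longrightarrow> g x = f x"
    by (metis smooth_onE)
  then show ?thesis
    by (metis Ck_on.simps(1) continuous_on_cong continuous_on_subset)
qed

lemma smooth_on_extension_derivative:
  assumes "smooth_on M F"
  obtains g D where "\<And>x. x \<in> M \<Longrightarrow> g x = F x" "\<And>p. p \<in> M \<Longrightarrow> (g has_derivative D p) (at p)"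
proof -
  from assms obtain U g where "M \<subseteq> U" "Ck_on (Suc 0) U g" "\<And>x. x \<in> M \<Longrightarrow> g x = F x"
    by (metis smooth_onE)
  then show ?thesis
    by (intro that[of g "\<lambda>p. frechet_derivative g (at p)"] Ck_on_SucD[of 0 U]) auto
qed

section \<open>Differentials on a submanifold\<close>

text \<open>
  The chain rule along a curve in \<open>M\<close>, for a function known only on \<open>M\<close>: near \<open>0\<close> the curve stays in
  \<open>M\<close>, so the differentiable extension \<open>g\<close> may replace \<open>F\<close>.
\<close>

lemma curve_derivative:
  assumes "\<And>x. x \<in> M \<Longrightarrow> g x = F x" "(g has_derivative D) (at p)" "curve_with_velocity M p v \<gamma>"
  shows "((\<lambda>t. F (\<gamma> t)) has_real_derivative D v) (at 0)"
proof -
  obtain e where e: "e > 0" "\<gamma> ` {-e<..<e} \<subseteq> M" and "\<gamma> 0 = p"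
    and v: "(\<gamma> has_vector_derivative v) (at 0)"
    using assms(3) by (auto simp: curve_with_velocity_def)
  have "((\<lambda>t. g (\<gamma> t)) has_derivative (\<lambda>h. D (h *\<^sub>R v))) (at 0)"
    using v assms(2) \<open>\<gamma> 0 = p\<close> unfolding has_vector_derivative_def
    by (intro has_derivative_compose[where g = g and f = \<gamma>]) auto
  moreover have "D (h *\<^sub>R v) = D v * h" for h
    using has_derivative_bounded_linear[OF assms(2)] by (simp add: bounded_linear.linear linear_cmul)
  ultimately have "((\<lambda>t. g (\<gamma> t)) has_real_derivative D v) (at 0)"
    by (simp add: has_field_derivative_def)
  then show ?thesis
    by (rule has_field_derivative_transform_within_open[where S = "{-e<..<e}"])
       (use e assms(1) in \<open>auto simp: image_subset_iff\<close>)
qed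

text \<open>
  By the previous lemma the derivative along a curve depends on its velocity alone, so the definite
  description that defines the differential denotes.
\<close>

lemma differential_eq:
  assumes "\<And>x. x \<in> M \<Longrightarrow> g x = F x" "(g has_derivative D) (at p)" "v \<in> tangent_space M p"
  shows "differential M F p v = D v"
proof -
  obtain \<gamma> where "curve_with_velocity M p v \<gamma>"
    using assms(3) by (auto simp: tangent_space_def)
  then show ?thesis
    unfolding differential_def
    using curve_derivative[OF assms(1,2)] DERIV_unique by (intro the_equality) blast+
qed

lemma differential_const: "v \<in> tangent_space M p \<Longrightarrow> differential M (\<lambda>_. c) p v = 0"
  by (rule differential_eq[where g = "\<lambda>_. c" and D = "\<lambda>_. 0"]) auto

lemma differential_add:
  assumes "smooth_on M F" "smooth_on M G" "p \<in> M" "v \<in> tangent_space M p"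
  shows "differential M (\<lambda>x. F x + G x) p v = differential M F p v + differential M G p v"
proof -
  obtain f D where f: "\<And>x. x \<in> M \<Longrightarrow> f x = F x" "\<And>p. p \<in> M \<Longrightarrow> (f has_derivative D p) (at p)"
    by (rule smooth_on_extension_derivative[OF assms(1)]) blast
  obtain g E where g: "\<And>x. x \<in> M \<Longrightarrow> g x = G x" "\<And>p. p \<in> M \<Longrightarrow> (g has_derivative E p) (at p)"
    by (rule smooth_on_extension_derivative[OF assms(2)]) blast
  have "differential M (\<lambda>x. F x + G x) p v = D p v + E p v"
    using f g assms(3,4)
    by (intro differential_eq[where g = "\<lambda>x. f x + g x" and D = "\<lambda>v. D p v + E p v"] has_derivative_add) auto
  moreover have "differential M F p v = D p v"
    using f assms(3,4) by (intro differential_eq)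
  moreover have "differential M G p v = E p v"
    using g assms(3,4) by (intro differential_eq)
  ultimately show ?thesis
    using f(1) g(1) assms(3) by simp
qed

lemma differential_mult:
  assumes "smooth_on M F" "smooth_on M G" "p \<in> M" "v \<in> tangent_space M p"
  shows "differential M (\<lambda>x. F x * G x) p v = F p * differential M G p v + differential M F p v * G p"
proof -
  obtain f D where f: "\<And>x. x \<in> M \<Longrightarrow> f x = F x" "\<And>p. p \<in> M \<Longrightarrow> (f has_derivative D p) (at p)"
    by (rule smooth_on_extension_derivative[OF assms(1)]) blast
  obtain g E where g: "\<And>x. x \<in> M \<Longrightarrow> g x = G x" "\<And>p. p \<in> M \<Longrightarrow> (g has_derivative E p) (at p)"
    by (rule smooth_on_extension_derivative[OF assms(2)]) blast
  have "differential M (\<lambda>x. F x * G x) p v = f p * E p v + D p v * g p"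
    using f g assms(3,4)
    by (intro differential_eq[where g = "\<lambda>x. f x * g x" and D = "\<lambda>v. f p * E p v + D p v * g p"] has_derivative_mult) auto
  moreover have "differential M F p v = D p v"
    using f assms(3,4) by (intro differential_eq)
  moreover have "differential M G p v = E p v"
    using g assms(3,4) by (intro differential_eq)
  ultimately show ?thesis
    using f(1) g(1) assms(3) by simp
qed

text \<open>
  The smooth functions whose differential is at each point a combination of those of \<open>A\<close> and \<open>B\<close>. This
  pointwise condition replaces ``smooth function of \<open>A\<close> and \<open>B\<close>'': it suffices for Poisson commutation
  and is visibly preserved by sums and products.
\<close>

definition dependent_functions ::
  "'a::euclidean_space set \<Rightarrow> ('a \<Rightarrow> real) \<Rightarrow> ('a \<Rightarrow> real) \<Rightarrow> ('a \<Rightarrow> real) set" where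
  "dependent_functions M A B =
     {F \<in> smooth_functions M. \<forall>p\<in>M. \<exists>a b. \<forall>v\<in>tangent_space M p.
        differential M F p v = a * differential M A p v + b * differential M B p v}"

lemma dependent_functions_left: "smooth_on M A \<Longrightarrow> A \<in> dependent_functions M A B"
  unfolding dependent_functions_def smooth_functions_def
  by simp (metis add_0_right mult_1 mult_zero_left)

lemma dependent_functions_right: "smooth_on M B \<Longrightarrow> B \<in> dependent_functions M A B"
  unfolding dependent_functions_def smooth_functions_def
  by simp (metis add_0_left mult_1 mult_zero_left)

lemma dependent_functions_const: "(\<lambda>_. c) \<in> dependent_functions M A B"
  unfolding dependent_functions_def smooth_functions_def
  by (auto intro!: exI[of _ 0] simp: differential_const smooth_on_const)

lemma dependent_functions_add:
  assumes "F \<in> dependent_functions M A B" "G \<in> dependent_functions M A B"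
  shows "(\<lambda>x. F x + G x) \<in> dependent_functions M A B"
proof -
  have sm: "smooth_on M F" "smooth_on M G"
    using assms by (auto simp: dependent_functions_def smooth_functions_def)
  have "\<exists>a b. \<forall>v\<in>tangent_space M p. differential M (\<lambda>x. F x + G x) p v =
      a * differential M A p v + b * differential M B p v" if "p \<in> M" for p
  proof -
    obtain a b a' b' where
      "\<forall>v\<in>tangent_space M p. differential M F p v = a * differential M A p v + b * differential M B p v"
      "\<forall>v\<in>tangent_space M p. differential M G p v = a' * differential M A p v + b' * differential M B p v"
      using assms \<open>p \<in> M\<close> unfolding dependent_functions_def by blast
    then show ?thesis
      using sm \<open>p \<in> M\<close>
      by (intro exI[of _ "a + a'"] exI[of _ "b + b'"]) (simp add: differential_add algebra_simps)
  qed
  then show ?thesis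
    using sm by (auto simp: dependent_functions_def smooth_functions_def smooth_on_add)
qed

lemma dependent_functions_mult:
  assumes "F \<in> dependent_functions M A B" "G \<in> dependent_functions M A B"
  shows "(\<lambda>x. F x * G x) \<in> dependent_functions M A B"
proof -
  have sm: "smooth_on M F" "smooth_on M G"
    using assms by (auto simp: dependent_functions_def smooth_functions_def)
  have "\<exists>a b. \<forall>v\<in>tangent_space M p. differential M (\<lambda>x. F x * G x) p v =
      a * differential M A p v + b * differential M B p v" if "p \<in> M" for p
  proof -
    obtain a b a' b' where
      "\<forall>v\<in>tangent_space M p. differential M F p v = a * differential M A p v + b * differential M B p v"
      "\<forall>v\<in>tangent_space M p. differential M G p v = a' * differential M A p v + b' * differential M B p v"
      using assms \<open>p \<in> M\<close> unfolding dependent_functions_def by blast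
    then show ?thesis
      using sm \<open>p \<in> M\<close>
      by (intro exI[of _ "F p * a' + a * G p"] exI[of _ "F p * b' + b * G p"])
         (simp add: differential_mult algebra_simps)
  qed
  then show ?thesis
    using sm by (auto simp: dependent_functions_def smooth_functions_def smooth_on_mult)
qed

lemma subspace_dependent_functions: "subspace (dependent_functions M A B)"
  unfolding subspace_def
proof (intro conjI ballI allI)
  show "0 \<in> dependent_functions M A B"
    unfolding zero_fun_def by (rule dependent_functions_const)
  show "F + G \<in> dependent_functions M A B"
    if "F \<in> dependent_functions M A B" "G \<in> dependent_functions M A B" for F G
    unfolding plus_fun_def using that by (rule dependent_functions_add)
  show "c *\<^sub>R F \<in> dependent_functions M A B" if "F \<in> dependent_functions M A B" for c F
    unfolding scaleR_fun_def real_scaleR_def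
    using dependent_functions_const that by (rule dependent_functions_mult)
qed

lemma polynomial_dependent_functions:
  fixes P :: "real \<times> real \<Rightarrow> real"
  assumes "real_polynomial_function P" "smooth_on M A" "smooth_on M B"
  shows "(\<lambda>x. P (A x, B x)) \<in> dependent_functions M A B"
  using assms(1)
proof (induction P rule: real_polynomial_function.induct)
  case (linear h)
  interpret bounded_linear h by fact
  have "h (s, t) = h (1, 0) * s + h (0, 1) * t" for s t
    using add[of "s *\<^sub>R (1, 0)" "t *\<^sub>R (0, 1)"] scaleR[of s "(1, 0)"] scaleR[of t "(0, 1)"]
    by simp
  then have "(\<lambda>x. h (A x, B x)) = (\<lambda>x. h (1, 0) * A x + h (0, 1) * B x)"
    by (rule ext)
  also have "\<dots> \<in> dependent_functions M A B"
    using assms(2,3)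
    by (intro dependent_functions_add dependent_functions_mult dependent_functions_const
        dependent_functions_left dependent_functions_right)
  finally show ?case .
qed (auto intro: dependent_functions_const dependent_functions_add dependent_functions_mult)

section \<open>The symplectic geometry of the product of two spheres\<close>

text \<open>
  The great circle through \<open>p\<close> with velocity \<open>v\<close>; for \<open>v = 0\<close> the formula is the constant curve, since
  then the sine vanishes.
\<close>

lemma great_circle:
  fixes p v :: "'a::euclidean_space"
  assumes "norm p = 1" "p \<bullet> v = 0"
  defines "\<gamma> \<equiv> \<lambda>t. cos (norm v * t) *\<^sub>R p + sin (norm v * t) *\<^sub>R (v /\<^sub>R norm v)"
  shows "norm (\<gamma> t) = 1" "\<gamma> 0 = p" "(\<gamma> has_vector_derivative v) (at 0)"
proof -
  define s c where "s = sin (norm v * t)" and "c = cos (norm v * t)"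
  have sc: "s * s + c * c = 1"
    unfolding s_def c_def by (metis power2_eq_square sin_cos_squared_add)
  have pp: "p \<bullet> p = 1"
    using assms(1) by (simp add: norm_eq_1)
  have "\<gamma> t \<bullet> \<gamma> t = 1"
  proof (cases "v = 0")
    case True
    then show ?thesis by (simp add: \<gamma>_def pp)
  next
    case False
    define u where "u = v /\<^sub>R norm v"
    have uu: "u \<bullet> u = 1"
      using False by (simp add: u_def dot_square_norm power2_eq_square field_simps)
    have pu: "p \<bullet> u = 0" "u \<bullet> p = 0"
      using assms(2) by (simp_all add: u_def inner_commute)
    have "\<gamma> t = c *\<^sub>R p + s *\<^sub>R u"
      by (simp add: \<gamma>_def s_def c_def u_def)
    then have "\<gamma> t \<bullet> \<gamma> t = c * c * (p \<bullet> p) + s * s * (u \<bullet> u)"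
      using pu by (simp add: inner_add_left inner_add_right)
    then show ?thesis using sc pp uu by simp
  qed
  then show "norm (\<gamma> t) = 1" by (simp add: norm_eq_1)
  show "\<gamma> 0 = p" by (simp add: \<gamma>_def)
  show "(\<gamma> has_vector_derivative v) (at 0)"
    unfolding \<gamma>_def by (auto intro!: derivative_eq_intros simp: has_vector_derivative_def fun_eq_iff)
qed

text \<open>
  A velocity is orthogonal to the position because $|p|^2$ is constant on each sphere, and conversely a
  pair of great circles realises every orthogonal pair.
\<close>

lemma tangent_space_S2_S2:
  assumes "p \<in> S2 \<times> S2"
  shows "tangent_space (S2 \<times> S2) p = {v. fst p \<bullet> fst v = 0 \<and> snd p \<bullet> snd v = 0}"
proof (intro equalityI subsetI)
  fix v assume "v \<in> tangent_space (S2 \<times> S2) p"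
  then obtain \<gamma> where \<gamma>: "curve_with_velocity (S2 \<times> S2) p v \<gamma>"
    by (auto simp: tangent_space_def)
  have "((\<lambda>t. 1) has_real_derivative fst p \<bullet> fst v + fst v \<bullet> fst p) (at 0)"
    by (rule curve_derivative[where F = "\<lambda>_. 1" and g = "\<lambda>x. fst x \<bullet> fst x", OF _ _ \<gamma>])
       (auto intro!: derivative_eq_intros simp: norm_eq_1)
  moreover have "((\<lambda>t. 1) has_real_derivative snd p \<bullet> snd v + snd v \<bullet> snd p) (at 0)"
    by (rule curve_derivative[where F = "\<lambda>_. 1" and g = "\<lambda>x. snd x \<bullet> snd x", OF _ _ \<gamma>])
       (auto intro!: derivative_eq_intros simp: norm_eq_1)
  ultimately show "v \<in> {v. fst p \<bullet> fst v = 0 \<and> snd p \<bullet> snd v = 0}"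
    using DERIV_unique[OF DERIV_const] by (fastforce simp: inner_commute)
next
  fix v assume v: "v \<in> {v. fst p \<bullet> fst v = 0 \<and> snd p \<bullet> snd v = 0}"
  obtain p1 p2 v1 v2 where pv: "p = (p1, p2)" "v = (v1, v2)" by fastforce
  define \<alpha> \<beta> where "\<alpha> = (\<lambda>t. cos (norm v1 * t) *\<^sub>R p1 + sin (norm v1 * t) *\<^sub>R (v1 /\<^sub>R norm v1))"
    and "\<beta> = (\<lambda>t. cos (norm v2 * t) *\<^sub>R p2 + sin (norm v2 * t) *\<^sub>R (v2 /\<^sub>R norm v2))"
  have \<alpha>: "norm (\<alpha> t) = 1" "\<alpha> 0 = p1" "(\<alpha> has_vector_derivative v1) (at 0)" for t
    using great_circle[of p1 v1] assms v unfolding pv \<alpha>_def by auto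
  have \<beta>: "norm (\<beta> t) = 1" "\<beta> 0 = p2" "(\<beta> has_vector_derivative v2) (at 0)" for t
    using great_circle[of p2 v2] assms v unfolding pv \<beta>_def by auto
  let ?\<gamma> = "\<lambda>t. (\<alpha> t, \<beta> t)"
  have split: "?\<gamma> = (\<lambda>t. (cos (norm v1 * t) *\<^sub>R (p1, 0) + sin (norm v1 * t) *\<^sub>R (v1 /\<^sub>R norm v1, 0))
      + (cos (norm v2 * t) *\<^sub>R (0, p2) + sin (norm v2 * t) *\<^sub>R (0, v2 /\<^sub>R norm v2)))"
    by (simp add: \<alpha>_def \<beta>_def fun_eq_iff)
  have "Ck_on k UNIV ?\<gamma>" for k
    unfolding split by (intro Ck_on_add Ck_on_trig open_UNIV)
  then have "smooth_on {-1<..<1} ?\<gamma>"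
    unfolding smooth_on_def by (intro exI[of _ UNIV] exI[of _ ?\<gamma>]) auto
  moreover have "?\<gamma> ` {-1<..<1} \<subseteq> S2 \<times> S2"
    using \<alpha>(1) \<beta>(1) by auto
  moreover have "(?\<gamma> has_vector_derivative v) (at 0)"
    unfolding pv by (intro has_vector_derivative_Pair \<alpha> \<beta>)
  ultimately have "curve_with_velocity (S2 \<times> S2) p v ?\<gamma>"
    unfolding curve_with_velocity_def using \<alpha>(2) \<beta>(2) pv
    by (intro conjI exI[of _ 1]) auto
  then show "v \<in> tangent_space (S2 \<times> S2) p"
    by (auto simp: tangent_space_def)
qed

definition is_gradient ::
  "'a::euclidean_space set \<Rightarrow> ('a \<Rightarrow> real) \<Rightarrow> 'a \<Rightarrow> 'a \<Rightarrow> bool" where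
  "is_gradient M F p g \<longleftrightarrow> (\<forall>v\<in>tangent_space M p. differential M F p v = g \<bullet> v)"

text \<open>
  On the unit sphere $p \times (p \times v) = - v$ for \<open>v\<close> tangent at \<open>p\<close>, and
  $\det(p, v, w) = (p \times v) \cdot w$, so \<open>\<iota>\<^bsub>X\<^esub> \<omega> = - dF\<close> is solved by $p \times g$. On the second
  sphere the form carries the factor \<open>R\<close>, whence \<open>1 / R\<close>. Only the tangential part of \<open>g\<close> matters, so any
  ambient gradient may be used.
\<close>

lemma hamiltonian_vector_field_S2_S2:
  assumes "R > 0" "p \<in> S2 \<times> S2" "is_gradient (S2 \<times> S2) F p g"
  shows "hamiltonian_vector_field (S2 \<times> S2) (omega R) F p =
    (cross3 (fst p) (fst g), (1 / R) *\<^sub>R cross3 (snd p) (snd g))"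
    (is "_ = ?X")
proof -
  obtain p1 p2 g1 g2 where p: "p = (p1, p2)" and g: "g = (g1, g2)" by fastforce
  have n: "norm p1 = 1" "norm p2 = 1" using assms(2) p by auto
  have grad: "differential (S2 \<times> S2) F p v = g \<bullet> v" if "v \<in> tangent_space (S2 \<times> S2) p" for v
    using assms(3) that by (simp add: is_gradient_def)
  have T: "v \<in> tangent_space (S2 \<times> S2) p \<longleftrightarrow> p1 \<bullet> fst v = 0 \<and> p2 \<bullet> snd v = 0" for v
    unfolding tangent_space_S2_S2[OF assms(2)] by (simp add: p)
  have om: "omega R p v w = cross3 p1 (fst v) \<bullet> fst w + R * (cross3 p2 (snd v) \<bullet> snd w)" for v w
  proof -
    have "q \<bullet> cross3 u y = cross3 q u \<bullet> y" for q u y :: "real^3"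
      by (metis cross_triple inner_commute)
    then show ?thesis by (simp add: omega_def omega_S2_def p)
  qed
  have X: "fst ?X = cross3 p1 g1" "snd ?X = (1 / R) *\<^sub>R cross3 p2 g2"
    by (simp_all add: p g)
  show ?thesis
    unfolding hamiltonian_vector_field_def
  proof (rule the_equality, intro conjI ballI)
    show "?X \<in> tangent_space (S2 \<times> S2) p"
      unfolding T X by (simp add: dot_cross_self)
  next
    fix w assume w: "w \<in> tangent_space (S2 \<times> S2) p"
    have "cross3 q (cross3 q h) \<bullet> y = - (h \<bullet> y)" if "norm q = 1" "q \<bullet> y = 0" for q h y :: "real^3"
      using that by (simp add: Lagrange norm_eq_1 inner_diff_left)
    then show "omega R p ?X w = - differential (S2 \<times> S2) F p w"
      unfolding om X grad[OF w] using w n assms(1) by (simp add: T g inner_prod_def cross_mult_right)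
  next
    fix v assume v: "v \<in> tangent_space (S2 \<times> S2) p \<and>
      (\<forall>w\<in>tangent_space (S2 \<times> S2) p. omega R p v w = - differential (S2 \<times> S2) F p w)"
    \<comment> \<open>The hypothesis concerns test vectors orthogonal to \<open>q\<close> only; all of them have the form
      \<open>cross3 q w\<close> with \<open>w\<close> arbitrary, which turns it into an identity for all \<open>w\<close>.\<close>
    have perp: "y = cross3 q h" if "norm q = 1" "q \<bullet> y = 0" "\<And>w. q \<bullet> w = 0 \<Longrightarrow> cross3 q y \<bullet> w = - (h \<bullet> w)"
      for q h y :: "real^3"
    proof -
      have "h \<bullet> cross3 q w = - (cross3 q y \<bullet> cross3 q w)" for w
        using that(3)[of "cross3 q w"] by (simp add: dot_cross_self)
      moreover have "cross3 q y \<bullet> cross3 q w = y \<bullet> w" for w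
        using that(1,2) by (simp add: dot_cross norm_eq_1 inner_commute[of y q])
      moreover have "cross3 q h \<bullet> w = - (h \<bullet> cross3 q w)" for w
        by (simp add: cross3_simps)
      ultimately have "cross3 q h \<bullet> w = y \<bullet> w" for w
        by simp
      then have "cross3 q h = y"
        using vector_eq_rdot[of "cross3 q h" y] by blast
      then show ?thesis by simp
    qed
    have eq: "cross3 p1 (fst v) \<bullet> w1 + R * (cross3 p2 (snd v) \<bullet> w2) = - (g1 \<bullet> w1) - g2 \<bullet> w2"
      if "p1 \<bullet> w1 = 0" "p2 \<bullet> w2 = 0" for w1 w2
    proof -
      have w: "(w1, w2) \<in> tangent_space (S2 \<times> S2) p"
        using that by (simp add: T)
      with v have "omega R p v (w1, w2) = - differential (S2 \<times> S2) F p (w1, w2)"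
        by blast
      then show ?thesis
        by (simp add: om grad[OF w] g inner_prod_def)
    qed
    have "fst v = cross3 p1 g1"
      using v n eq[of _ 0] by (intro perp) (auto simp: T)
    moreover have "R *\<^sub>R snd v = cross3 p2 g2"
      using v n eq[of 0] by (intro perp) (auto simp: T cross_mult_right)
    then have "(1 / R) *\<^sub>R (R *\<^sub>R snd v) = (1 / R) *\<^sub>R cross3 p2 g2"
      by (rule arg_cong)
    then have "snd v = (1 / R) *\<^sub>R cross3 p2 g2"
      using assms(1) by simp
    ultimately show "v = ?X"
      unfolding prod_eq_iff X by blast
  qed
qed

lemma poisson_bracket_S2_S2:
  assumes "R > 0" "p \<in> S2 \<times> S2" "is_gradient (S2 \<times> S2) F p f" "is_gradient (S2 \<times> S2) G p g"
  shows "poisson_bracket (S2 \<times> S2) (omega R) F G p =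
    fst p \<bullet> cross3 (fst g) (fst f) + (1 / R) * (snd p \<bullet> cross3 (snd g) (snd f))"
proof -
  have X: "hamiltonian_vector_field (S2 \<times> S2) (omega R) F p =
      (cross3 (fst p) (fst f), (1 / R) *\<^sub>R cross3 (snd p) (snd f))"
    "hamiltonian_vector_field (S2 \<times> S2) (omega R) G p =
      (cross3 (fst p) (fst g), (1 / R) *\<^sub>R cross3 (snd p) (snd g))"
    by (rule hamiltonian_vector_field_S2_S2[OF assms(1,2)], fact)+
  have "q \<bullet> cross3 (cross3 q u) (cross3 q v) = q \<bullet> cross3 u v" if "norm q = 1" for q u v :: "real^3"
  proof -
    have "q \<bullet> cross3 (cross3 q u) (cross3 q v) = (q \<bullet> q) * (q \<bullet> cross3 u v)"
      by (simp add: cross3_simps)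
    then show ?thesis using that by (simp add: norm_eq_1)
  qed
  then show ?thesis
    using assms(1,2)
    by (auto simp: poisson_bracket_def X omega_def omega_S2_def cross_mult_left cross_mult_right mem_Times_iff)
qed

text \<open>
  The bracket of two functions is a bilinear antisymmetric form in their gradients at the point. On the
  plane spanned by the gradients of \<open>A\<close> and \<open>B\<close> it is a multiple of the bracket of \<open>A\<close> and \<open>B\<close>.
\<close>

lemma dependent_functions_poisson_commute:
  assumes "R > 0"
    and AB: "\<And>p. p \<in> S2 \<times> S2 \<Longrightarrow> \<exists>a b. is_gradient (S2 \<times> S2) A p a \<and> is_gradient (S2 \<times> S2) B p b \<and>
      fst p \<bullet> cross3 (fst a) (fst b) + (1 / R) * (snd p \<bullet> cross3 (snd a) (snd b)) = 0"
    and FG: "F \<in> dependent_functions (S2 \<times> S2) A B" "G \<in> dependent_functions (S2 \<times> S2) A B"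
  shows "poisson_commute (S2 \<times> S2) (omega R) F G"
  unfolding poisson_commute_def
proof
  fix p assume p: "p \<in> S2 \<times> S2"
  obtain a b where ab: "is_gradient (S2 \<times> S2) A p a" "is_gradient (S2 \<times> S2) B p b"
    and zero: "fst p \<bullet> cross3 (fst a) (fst b) + (1 / R) * (snd p \<bullet> cross3 (snd a) (snd b)) = 0"
    using AB[OF p] by blast
  have grad: "\<exists>c d. is_gradient (S2 \<times> S2) K p (c *\<^sub>R a + d *\<^sub>R b)"
    if K: "K \<in> dependent_functions (S2 \<times> S2) A B" for K
  proof -
    obtain c d where "\<forall>v\<in>tangent_space (S2 \<times> S2) p. differential (S2 \<times> S2) K p v =
        c * differential (S2 \<times> S2) A p v + d * differential (S2 \<times> S2) B p v"
      using K p unfolding dependent_functions_def by blast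
    then show ?thesis
      using ab unfolding is_gradient_def
      by (intro exI[of _ c] exI[of _ d]) (simp add: inner_add_left)
  qed
  obtain c d c' d' where "is_gradient (S2 \<times> S2) F p (c *\<^sub>R a + d *\<^sub>R b)"
    "is_gradient (S2 \<times> S2) G p (c' *\<^sub>R a + d' *\<^sub>R b)"
    using grad[OF FG(1)] grad[OF FG(2)] by blast
  note bracket = poisson_bracket_S2_S2[OF assms(1) p this]
  have det: "q \<bullet> cross3 (c' *\<^sub>R u + d' *\<^sub>R v) (c *\<^sub>R u + d *\<^sub>R v) = (c' * d - d' * c) * (q \<bullet> cross3 u v)"
    for q u v :: "real^3"
    by (simp add: cross3_simps)
  have "poisson_bracket (S2 \<times> S2) (omega R) F G p = (c' * d - d' * c) *
      (fst p \<bullet> cross3 (fst a) (fst b) + (1 / R) * (snd p \<bullet> cross3 (snd a) (snd b)))"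
    unfolding bracket fst_add snd_add fst_scaleR snd_scaleR det by (simp add: algebra_simps diff_divide_distrib)
  then show "poisson_bracket (S2 \<times> S2) (omega R) F G p = 0"
    using zero by simp
qed

section \<open>Commutation of the two integrals\<close>

lemma bounded_linear_heights:
  "bounded_linear (\<lambda>x :: (real^3) \<times> (real^3). (fst x $ 3, snd x $ 3))"
  by (intro bounded_linear_Pair bounded_linear_compose[OF bounded_linear_vec_nth]
      bounded_linear_fst bounded_linear_snd)

lemma J_fun_eq: "J_fun R x = fst x $ 3 + R * snd x $ 3"
  by (simp add: J_fun_def case_prod_beta)

lemma H_fun_eq: "H_fun f x = fst x \<bullet> snd x - f (fst x $ 3, snd x $ 3)"
  by (simp add: H_fun_def case_prod_beta inner_vec_def sum_3)

lemma heights_in_square: "x \<in> S2 \<times> S2 \<Longrightarrow> (fst x $ 3, snd x $ 3) \<in> {-1..1} \<times> {-1..1}"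
  using component_le_norm_cart[of "fst x" 3] component_le_norm_cart[of "snd x" 3] by auto

lemma smooth_on_J_fun: "smooth_on X (J_fun R)"
  unfolding J_fun_eq[abs_def]
  by (intro smooth_on_linear bounded_linear_add bounded_linear_const_mult
      bounded_linear_compose[OF bounded_linear_vec_nth] bounded_linear_fst bounded_linear_snd)

lemma smooth_on_H_fun:
  assumes "smooth_on ({-1..1} \<times> {-1..1}) f"
  shows "smooth_on (S2 \<times> S2) (H_fun f)"
proof -
  have coord: "smooth_on X (\<lambda>x :: (real^3) \<times> (real^3). fst x $ i)" "smooth_on X (\<lambda>x :: (real^3) \<times> (real^3). snd x $ i)"
    for X i
    by (intro smooth_on_linear bounded_linear_compose[OF bounded_linear_vec_nth]
        bounded_linear_fst bounded_linear_snd)+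
  have "smooth_on (S2 \<times> S2) (\<lambda>x. f (fst x $ 3, snd x $ 3))"
    by (rule smooth_on_compose_linear[OF bounded_linear_heights assms]) (use heights_in_square in blast)
  then have "smooth_on (S2 \<times> S2) (\<lambda>x. fst x $ 1 * snd x $ 1 + fst x $ 2 * snd x $ 2 + fst x $ 3 * snd x $ 3
      + (-1) * f (fst x $ 3, snd x $ 3))"
    by (intro smooth_on_add smooth_on_mult smooth_on_const coord)
  then show ?thesis
    by (simp add: H_fun_eq[abs_def] inner_vec_def sum_3)
qed

lemma gradient_J_fun: "is_gradient M (J_fun R) p (axis 3 1, R *\<^sub>R axis 3 1)"
  unfolding is_gradient_def
proof
  fix v assume "v \<in> tangent_space M p"
  moreover have "bounded_linear (J_fun R)"
    unfolding J_fun_eq[abs_def]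
    by (intro bounded_linear_add bounded_linear_const_mult
        bounded_linear_compose[OF bounded_linear_vec_nth] bounded_linear_fst bounded_linear_snd)
  ultimately have "differential M (J_fun R) p v = J_fun R v"
    by (intro differential_eq[where g = "J_fun R"] bounded_linear_imp_has_derivative) auto
  then show "differential M (J_fun R) p v = (axis 3 1, R *\<^sub>R axis 3 1) \<bullet> v"
    by (simp add: J_fun_eq inner_prod_def inner_axis' )
qed

lemma gradient_H_fun:
  assumes "smooth_on ({-1..1} \<times> {-1..1}) f" "p \<in> S2 \<times> S2"
  shows "\<exists>c d. is_gradient (S2 \<times> S2) (H_fun f) p (snd p - c *\<^sub>R axis 3 1, fst p - d *\<^sub>R axis 3 1)"
proof -
  let ?L = "\<lambda>x :: (real^3) \<times> (real^3). (fst x $ 3, snd x $ 3)"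
  obtain g D where g: "\<And>y. y \<in> {-1..1} \<times> {-1..1} \<Longrightarrow> g y = f y"
    "\<And>y. y \<in> {-1..1} \<times> {-1..1} \<Longrightarrow> (g has_derivative D y) (at y)"
    by (rule smooth_on_extension_derivative[OF assms(1)]) blast
  have "((\<lambda>x. g (?L x)) has_derivative (\<lambda>v. D (?L p) (?L v))) (at p)"
    by (rule has_derivative_compose[OF bounded_linear_imp_has_derivative[OF bounded_linear_heights]
        g(2)[OF heights_in_square[OF assms(2)]]])
  then have der: "((\<lambda>x. fst x \<bullet> snd x - g (?L x)) has_derivative
      (\<lambda>v. fst p \<bullet> snd v + fst v \<bullet> snd p - D (?L p) (?L v))) (at p)"
    by (auto intro!: derivative_eq_intros)
  define c d where "c = D (?L p) (1, 0)" and "d = D (?L p) (0, 1)"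
  interpret D: bounded_linear "D (?L p)"
    using g(2)[OF heights_in_square[OF assms(2)]] by (rule has_derivative_bounded_linear)
  have D: "D (?L p) (s, t) = c * s + d * t" for s t
    using D.add[of "s *\<^sub>R (1, 0)" "t *\<^sub>R (0, 1)"] D.scaleR[of s "(1, 0)"] D.scaleR[of t "(0, 1)"]
    by (simp add: c_def d_def)
  have "differential (S2 \<times> S2) (H_fun f) p v = (snd p - c *\<^sub>R axis 3 1, fst p - d *\<^sub>R axis 3 1) \<bullet> v"
    if "v \<in> tangent_space (S2 \<times> S2) p" for v
  proof -
    have "differential (S2 \<times> S2) (H_fun f) p v = fst p \<bullet> snd v + fst v \<bullet> snd p - D (?L p) (?L v)"
      using g(1) heights_in_square by (intro differential_eq[OF _ der that]) (simp add: H_fun_eq)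
    then show ?thesis
      by (simp add: D inner_prod_def inner_diff_left inner_axis' inner_commute[of "snd p" "fst v"])
  qed
  then show ?thesis
    unfolding is_gradient_def by blast
qed

text \<open>
  The gradient of \<open>f (z\<^sub>1, z\<^sub>2)\<close> is vertical on both spheres, as is that of \<open>J\<close>, so \<open>f\<close> drops out. The two
  remaining terms $\det(p_1, e_3, p_2)$ and $\det(p_2, e_3, p_1)$ cancel: the factor \<open>R\<close> in \<open>J\<close> is
  the one by which the second form is scaled.
\<close>

lemma J_H_dependent_commute:
  assumes "R > 0" "smooth_on ({-1..1} \<times> {-1..1}) f"
    and "F \<in> dependent_functions (S2 \<times> S2) (J_fun R) (H_fun f)"
    and "G \<in> dependent_functions (S2 \<times> S2) (J_fun R) (H_fun f)"
  shows "poisson_commute (S2 \<times> S2) (omega R) F G"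
proof (rule dependent_functions_poisson_commute[OF assms(1) _ assms(3,4)])
  fix p :: "(real^3) \<times> (real^3)" assume "p \<in> S2 \<times> S2"
  then obtain c d where H: "is_gradient (S2 \<times> S2) (H_fun f) p (snd p - c *\<^sub>R axis 3 1, fst p - d *\<^sub>R axis 3 1)"
    using gradient_H_fun[OF assms(2)] by blast
  have "fst p \<bullet> cross3 (axis 3 1) (snd p - c *\<^sub>R axis 3 1)
      + (1 / R) * (snd p \<bullet> cross3 (R *\<^sub>R axis 3 1) (fst p - d *\<^sub>R axis 3 1)) = 0"
    using assms(1) by (simp add: cross3_simps axis_def)
  then show "\<exists>a b. is_gradient (S2 \<times> S2) (J_fun R) p a \<and> is_gradient (S2 \<times> S2) (H_fun f) p b \<and>
      fst p \<bullet> cross3 (fst a) (fst b) + (1 / R) * (snd p \<bullet> cross3 (snd a) (snd b)) = 0"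
    using H gradient_J_fun
    by (intro exI[of _ "(axis 3 1, R *\<^sub>R axis 3 1)"]
        exI[of _ "(snd p - c *\<^sub>R axis 3 1, fst p - d *\<^sub>R axis 3 1)"] conjI) simp_all
qed

section \<open>The displacing symmetry\<close>

definition half_turns :: "(real^3) \<times> (real^3) \<Rightarrow> (real^3) \<times> (real^3)" where
  "half_turns x =
     (vector [fst x $ 1, - fst x $ 2, - fst x $ 3], vector [- snd x $ 1, snd x $ 2, - snd x $ 3])"

text \<open>
  The function $\pi (x_1 + R y_2)$ has Hamiltonian vector field
  $(\pi\, p_1 \times e_1, \pi\, p_2 \times e_2)$, whose flow rotates both spheres with angular velocity
  \<open>\<pi>\<close>; the half turns are reached at time \<open>1\<close>.
\<close>

lemma half_turns_Ham:
  assumes "R > 0"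
  shows "half_turns \<in> Ham (S2 \<times> S2) (omega R)"
proof -
  define H :: "real \<Rightarrow> (real^3) \<times> (real^3) \<Rightarrow> real" where
    "H = (\<lambda>_ x. pi * fst x $ 1 + (R * pi) * snd x $ 2)"
  have lin: "bounded_linear (H t)" for t
    unfolding H_def
    by (intro bounded_linear_add bounded_linear_const_mult
        bounded_linear_compose[OF bounded_linear_vec_nth] bounded_linear_fst bounded_linear_snd)
  have "smooth_on (UNIV \<times> (S2 \<times> S2)) (\<lambda>y. H 0 (snd y))"
    by (rule smooth_on_linear[OF bounded_linear_compose[OF lin bounded_linear_snd]])
  then have "time_dependent_hamiltonian (S2 \<times> S2) H"
    by (auto simp: time_dependent_hamiltonian_def H_def case_prod_unfold)
  moreover have X: "hamiltonian_vector_field (S2 \<times> S2) (omega R) (H t) p =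
      (pi *\<^sub>R cross3 (fst p) (axis 1 1), pi *\<^sub>R cross3 (snd p) (axis 2 1))" if "p \<in> S2 \<times> S2" for t p
  proof -
    have "differential (S2 \<times> S2) (H t) p v = (pi *\<^sub>R axis 1 1, (R * pi) *\<^sub>R axis 2 1) \<bullet> v"
      if "v \<in> tangent_space (S2 \<times> S2) p" for v
    proof -
      have "differential (S2 \<times> S2) (H t) p v = H t v"
        using lin that by (intro differential_eq[where g = "H t"] bounded_linear_imp_has_derivative) auto
      then show ?thesis
        by (simp add: H_def inner_prod_def inner_axis')
    qed
    then have "is_gradient (S2 \<times> S2) (H t) p (pi *\<^sub>R axis 1 1, (R * pi) *\<^sub>R axis 2 1)"
      by (simp add: is_gradient_def)
    from hamiltonian_vector_field_S2_S2[OF assms that this] show ?thesis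
      using assms by (simp add: cross_mult_right)
  qed
  define \<psi> where "\<psi> = (\<lambda>t (x :: (real^3) \<times> (real^3)).
    (fst x $ 1 *\<^sub>R axis 1 1 + (cos (pi * t) * fst x $ 2 + sin (pi * t) * fst x $ 3) *\<^sub>R axis 2 1
       + (cos (pi * t) * fst x $ 3 - sin (pi * t) * fst x $ 2) *\<^sub>R axis 3 1 :: real^3,
     (cos (pi * t) * snd x $ 1 - sin (pi * t) * snd x $ 3) *\<^sub>R axis 1 1 + snd x $ 2 *\<^sub>R axis 2 1
       + (cos (pi * t) * snd x $ 3 + sin (pi * t) * snd x $ 1) *\<^sub>R axis 3 1 :: real^3))"
  have "is_time1_map (S2 \<times> S2) (omega R) H half_turns"
    unfolding is_time1_map_def
  proof (intro exI[of _ \<psi>] ballI conjI allI)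
    fix x :: "(real^3) \<times> (real^3)" and t :: real assume x: "x \<in> S2 \<times> S2"
    show "\<psi> 0 x = x" "\<psi> 1 x = half_turns x"
      by (simp_all add: \<psi>_def half_turns_def prod_eq_iff vec_eq_iff forall_3 axis_def vector_3)
    define s c where "s = sin (pi * t)" and "c = cos (pi * t)"
    have sc: "c * c = 1 - s * s"
      unfolding s_def c_def using sin_cos_squared_add[of "pi * t"] by (simp add: power2_eq_square algebra_simps)
    have rot: "(c * y + s * z) * (c * y + s * z) + (c * z - s * y) * (c * z - s * y) = y * y + z * z"
      for y z :: real
      using sc by algebra
    show M: "\<psi> t x \<in> S2 \<times> S2"
      using x rot[of "fst x $ 2" "fst x $ 3"] rot[of "snd x $ 3" "snd x $ 1"]
      by (simp add: \<psi>_def mem_Times_iff norm_eq_1 inner_vec_def sum_3 axis_def flip: s_def c_def)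
    show "((\<lambda>s. \<psi> s x) has_vector_derivative
        hamiltonian_vector_field (S2 \<times> S2) (omega R) (H t) (\<psi> t x)) (at t)"
      unfolding X[OF M] unfolding \<psi>_def
      by (rule has_vector_derivative_Pair;
          auto intro!: derivative_eq_intros simp: has_vector_derivative_def fun_eq_iff vec_eq_iff forall_3
            axis_def cross3_def vector_3 algebra_simps)
  qed
  with \<open>time_dependent_hamiltonian (S2 \<times> S2) H\<close> show ?thesis
    by (auto simp: Ham_def)
qed

lemma half_turns_in_S2_S2: "x \<in> S2 \<times> S2 \<Longrightarrow> half_turns x \<in> S2 \<times> S2"
  by (auto simp: half_turns_def norm_eq_1 inner_vec_def sum_3 vector_3)

lemma continuous_on_half_turns: "continuous_on X half_turns"
proof -
  have "linear half_turns"
    by (rule linearI) (simp_all add: half_turns_def prod_eq_iff vec_eq_iff forall_3 vector_3)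
  then show ?thesis
    by (simp add: linear_continuous_on linear_conv_bounded_linear)
qed

lemma J_fun_half_turns: "J_fun R (half_turns x) = - J_fun R x"
  by (simp add: J_fun_eq half_turns_def vector_3)

text \<open>
  On \<open>J = 0\<close>, with \<open>z\<close> the height on the second sphere, the sum of the two values of \<open>H\<close> is
  \<open>- 2 * R * z\<^sup>2 - f (- R * z, z) - f (R * z, - z)\<close>, which is \<open>2 * F_fun R f z\<close>.
\<close>

lemma H_fun_half_turns:
  assumes "\<forall>z\<in>{-1..1}. \<bar>R * z\<bar> \<le> 1 \<longrightarrow> F_fun R f z = 0" "x \<in> S2 \<times> S2" "J_fun R x = 0"
  shows "H_fun f (half_turns x) = - H_fun f x"
proof -
  define z where "z = snd x $ 3"
  have fst: "fst x $ 3 = - R * z"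
    using assms(3) by (simp add: J_fun_eq z_def)
  have "z \<in> {-1..1}" "\<bar>R * z\<bar> \<le> 1"
    using heights_in_square[OF assms(2)] fst by (auto simp: z_def)
  then have "F_fun R f z = 0"
    using assms(1) by blast
  then have "f (- R * z, z) + f (R * z, - z) = - 2 * R * z\<^sup>2"
    by (simp add: F_fun_def)
  then show ?thesis
    using fst by (simp add: H_fun_eq half_turns_def inner_vec_def sum_3 vector_3 z_def[symmetric] power2_eq_square)
qed

section \<open>The fibre over the origin is a stem\<close>

lemma origin_in_Phi_image:
  assumes "\<forall>z\<in>{-1..1}. \<bar>R * z\<bar> \<le> 1 \<longrightarrow> F_fun R f z = 0"
  shows "(axis 1 1, axis 2 1) \<in> fiber (S2 \<times> S2) (Phi R f) (0, 0)"
proof -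
  have "F_fun R f 0 = 0"
    using assms by simp
  moreover have "axis (1::3) 1 $ 3 = (0 :: real)" "axis (2::3) 1 $ 3 = (0 :: real)"
    by (simp_all add: axis_def)
  ultimately show ?thesis
    by (simp add: fiber_def Phi_def J_fun_eq H_fun_eq F_fun_def inner_axis_axis)
qed

lemma continuous_on_Phi:
  assumes "smooth_on ({-1..1} \<times> {-1..1}) f"
  shows "continuous_on (S2 \<times> S2) (Phi R f)"
  unfolding Phi_def using smooth_on_imp_continuous_on[OF smooth_on_J_fun]
    smooth_on_imp_continuous_on[OF smooth_on_H_fun[OF assms]]
  by (intro continuous_on_Pair)

lemma closed_fiber:
  fixes \<Phi> :: "'a::t1_space \<Rightarrow> 'b::t1_space"
  assumes "closed M" "continuous_on M \<Phi>"
  shows "closed (fiber M \<Phi> q)"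
proof -
  have "fiber M \<Phi> q = M \<inter> \<Phi> -` {q}"
    by (auto simp: fiber_def)
  then show ?thesis
    using continuous_on_closed_vimage[OF assms(1)] assms(2) by (auto simp: Int_commute)
qed

lemma displaceable_closed:
  assumes "\<phi> \<in> Ham M \<omega>" "closed D" "X \<subseteq> D" "\<And>x. x \<in> X \<Longrightarrow> \<phi> x \<notin> D"
  shows "displaceable_from M \<omega> X X"
  using assms closure_minimal[OF assms(3,2)] by (auto simp: displaceable_from_def)

lemma displaceable_fiber_Phi:
  assumes "R > 0" "smooth_on ({-1..1} \<times> {-1..1}) f"
    and "\<forall>z\<in>{-1..1}. \<bar>R * z\<bar> \<le> 1 \<longrightarrow> F_fun R f z = 0"
    and "q \<noteq> (0, 0)"
  shows "displaceable_from (S2 \<times> S2) (omega R)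
    (fiber (S2 \<times> S2) (Phi R f) q) (fiber (S2 \<times> S2) (Phi R f) q)"
proof (rule displaceable_closed[OF half_turns_Ham[OF assms(1)] _ subset_refl])
  show "closed (fiber (S2 \<times> S2) (Phi R f) q)"
    by (intro closed_fiber continuous_on_Phi assms closed_Times closed_sphere)
  show "half_turns x \<notin> fiber (S2 \<times> S2) (Phi R f) q" if "x \<in> fiber (S2 \<times> S2) (Phi R f) q" for x
    using that assms(4) J_fun_half_turns[of R x] H_fun_half_turns[OF assms(3), of x]
    by (cases "J_fun R x = 0") (auto simp: fiber_def Phi_def)
qed

lemma moment_map_span_eq_iff:
  "moment_map (span B) x = moment_map (span B) y \<longleftrightarrow> (\<forall>F\<in>B. F x = F y)"
proof
  assume "moment_map (span B) x = moment_map (span B) y"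
  then show "\<forall>F\<in>B. F x = F y"
    by (metis moment_map_def restrict_apply' span_base)
next
  assume B: "\<forall>F\<in>B. F x = F y"
  have "subspace {F :: 'a \<Rightarrow> real. F x = F y}"
    by (auto simp: subspace_def scaleR_fun_def)
  with B have "span B \<subseteq> {F. F x = F y}"
    by (intro span_minimal) auto
  then show "moment_map (span B) x = moment_map (span B) y"
    by (auto simp: moment_map_def restrict_def fun_eq_iff)
qed

lemma fiber_moment_map_Phi:
  assumes "x \<in> M"
  shows "fiber M (moment_map (span {J_fun R, H_fun f})) (moment_map (span {J_fun R, H_fun f}) x) =
    fiber M (Phi R f) (Phi R f x)"
  by (auto simp: fiber_def moment_map_span_eq_iff Phi_def)

lemma stem_fiber_Phi:
  assumes "R > 0" "smooth_on ({-1..1} \<times> {-1..1}) f"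
    and "\<forall>z\<in>{-1..1}. \<bar>R * z\<bar> \<le> 1 \<longrightarrow> F_fun R f z = 0"
  shows "stem (S2 \<times> S2) (omega R) (fiber (S2 \<times> S2) (Phi R f) (0, 0))"
proof -
  let ?M = "S2 \<times> S2 :: ((real^3) \<times> (real^3)) set"
  let ?A = "span {J_fun R, H_fun f}"
  let ?X = "fiber ?M (Phi R f) (0, 0)"
  obtain x0 where x0: "x0 \<in> ?X"
    using origin_in_Phi_image[OF assms(3)] by blast
  then have x0': "x0 \<in> ?M" "Phi R f x0 = (0, 0)"
    by (auto simp: fiber_def)
  have dep: "?A \<subseteq> dependent_functions ?M (J_fun R) (H_fun f)"
    by (intro span_minimal subspace_dependent_functions)
       (simp add: dependent_functions_left dependent_functions_right smooth_on_J_fun smooth_on_H_fun assms)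
  have "poisson_commutative_subspace ?M (omega R) ?A"
    unfolding poisson_commutative_subspace_def
  proof (intro conjI ballI)
    show "?A \<subseteq> smooth_functions ?M"
      using dep by (auto simp: dependent_functions_def)
    show "poisson_commute ?M (omega R) F G" if "F \<in> ?A" "G \<in> ?A" for F G
      using dep that by (intro J_H_dependent_commute[OF assms(1,2)]) auto
  qed (rule subspace_span)
  moreover have "finite_dimensional ?A"
    unfolding finite_dimensional_def by (intro exI[of _ "{J_fun R, H_fun f}"]) simp
  moreover have "\<exists>p\<in>moment_map ?A ` ?M. ?X = fiber ?M (moment_map ?A) p"
    using fiber_moment_map_Phi[OF x0'(1)] x0' by (metis imageI)
  moreover have "displaceable_from ?M (omega R) (fiber ?M (moment_map ?A) q) (fiber ?M (moment_map ?A) q)"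
    if q: "fiber ?M (moment_map ?A) q \<noteq> {}" "fiber ?M (moment_map ?A) q \<noteq> ?X" for q
  proof -
    obtain y where y: "y \<in> ?M" "moment_map ?A y = q"
      using q(1) by (auto simp: fiber_def)
    have "fiber ?M (moment_map ?A) q = fiber ?M (Phi R f) (Phi R f y)"
      using fiber_moment_map_Phi[OF y(1)] y(2) by metis
    moreover from this q(2) have "Phi R f y \<noteq> (0, 0)"
      by metis
    ultimately show ?thesis
      using displaceable_fiber_Phi[OF assms] by simp
  qed
  moreover have "closedin (top_of_set ?M) ?X"
    by (intro closed_subset closed_fiber continuous_on_Phi assms closed_Times closed_sphere)
       (auto simp: fiber_def)
  ultimately show ?thesis
    unfolding stem_def by blast
qed

section \<open>Superheaviness\<close>

text \<open>
  Stability in the form in which it is used: monotone for \<open>c = 0\<close>, continuous in the uniform norm for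
  small \<open>c\<close>.
\<close>

lemma quasi_state_mono:
  assumes "partial_symplectic_quasi_state M \<omega> \<zeta>" "M \<noteq> {}"
    and "continuous_on M F" "continuous_on M G" "\<And>x. x \<in> M \<Longrightarrow> F x \<le> G x + c"
  shows "\<zeta> F \<le> \<zeta> G + c"
proof -
  have "\<zeta> F - \<zeta> G \<le> (SUP x\<in>M. F x - G x)"
    using assms(1,3,4) unfolding partial_symplectic_quasi_state_def continuous_functions_def by blast
  also have "\<dots> \<le> c"
    using assms(2,5) by (intro cSUP_least) (auto simp: algebra_simps)
  finally show ?thesis by simp
qed

lemma quasi_state_vanishes:
  assumes "partial_symplectic_quasi_state M \<omega> \<zeta>" "continuous_on M F"
    and "\<phi> \<in> Ham M \<omega>" "closed D" "{x \<in> M. F x \<noteq> 0} \<subseteq> D" "\<And>x. x \<in> M \<inter> D \<Longrightarrow> \<phi> x \<notin> D"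
  shows "\<zeta> F = 0"
proof -
  have "supp M F \<subseteq> M \<inter> D"
    using closure_minimal[OF assms(5,4)] by (auto simp: supp_def)
  then have "displaceable_from M \<omega> (supp M F) (supp M F)"
    using assms(6) by (intro displaceable_closed[OF assms(3,4)]) auto
  then show ?thesis
    using assms(1,2) unfolding partial_symplectic_quasi_state_def continuous_functions_def by blast
qed

text \<open>
  By the Weierstrass theorem polynomials in \<open>A\<close> and \<open>B\<close> approximate the two functions uniformly. They
  are smooth and commute, so quasi-subadditivity applies to them, and stability carries the inequality
  over to the limit. Continuous cut-off functions of \<open>A\<close> and \<open>B\<close> may therefore be used in place of
  smooth ones.
\<close>

lemma quasi_state_subadditive_joint:
  fixes g1 g2 :: "real \<times> real \<Rightarrow> real"
  assumes \<zeta>: "partial_symplectic_quasi_state M \<omega> \<zeta>" and M: "M \<noteq> {}" "compact M"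
    and AB: "smooth_on M A" "smooth_on M B"
    and commute: "\<And>F G. F \<in> dependent_functions M A B \<Longrightarrow> G \<in> dependent_functions M A B \<Longrightarrow>
        poisson_commute M \<omega> F G"
    and g: "continuous_on UNIV g1" "continuous_on UNIV g2"
  shows "\<zeta> (\<lambda>x. g1 (A x, B x) + g2 (A x, B x)) \<le> \<zeta> (\<lambda>x. g1 (A x, B x)) + \<zeta> (\<lambda>x. g2 (A x, B x))"
proof (rule field_le_epsilon)
  fix e :: real assume "e > 0"
  define \<Phi> where "\<Phi> x = (A x, B x)" for x
  have \<Phi>: "continuous_on M \<Phi>"
    unfolding \<Phi>_def using AB smooth_on_imp_continuous_on by (intro continuous_on_Pair) auto
  then have K: "compact (\<Phi> ` M)"
    using M(2) by (rule compact_continuous_image)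
  have e4: "e / 4 > 0" using \<open>e > 0\<close> by simp
  obtain p1 where p1: "real_polynomial_function p1" "\<And>y. y \<in> \<Phi> ` M \<Longrightarrow> \<bar>g1 y - p1 y\<bar> < e / 4"
    using Stone_Weierstrass_real_polynomial_function[OF K continuous_on_subset[OF g(1)] e4] by auto
  obtain p2 where p2: "real_polynomial_function p2" "\<And>y. y \<in> \<Phi> ` M \<Longrightarrow> \<bar>g2 y - p2 y\<bar> < e / 4"
    using Stone_Weierstrass_real_polynomial_function[OF K continuous_on_subset[OF g(2)] e4] by auto
  have dep: "(\<lambda>x. p1 (\<Phi> x)) \<in> dependent_functions M A B" "(\<lambda>x. p2 (\<Phi> x)) \<in> dependent_functions M A B"
    unfolding \<Phi>_def using polynomial_dependent_functions AB p1(1) p2(1) by auto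
  then have "(\<lambda>x. p1 (\<Phi> x)) \<in> smooth_functions M" "(\<lambda>x. p2 (\<Phi> x)) \<in> smooth_functions M"
    by (auto simp: dependent_functions_def)
  then have sub: "\<zeta> (\<lambda>x. p1 (\<Phi> x) + p2 (\<Phi> x)) \<le> \<zeta> (\<lambda>x. p1 (\<Phi> x)) + \<zeta> (\<lambda>x. p2 (\<Phi> x))"
    using \<zeta> commute[OF dep] unfolding partial_symplectic_quasi_state_def by blast
  have cp: "continuous_on M (\<lambda>x. p1 (\<Phi> x))" "continuous_on M (\<lambda>x. p2 (\<Phi> x))"
    using \<open>(\<lambda>x. p1 (\<Phi> x)) \<in> smooth_functions M\<close> \<open>(\<lambda>x. p2 (\<Phi> x)) \<in> smooth_functions M\<close>
      smooth_on_imp_continuous_on by (auto simp: smooth_functions_def)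
  have cg: "continuous_on M (\<lambda>x. g1 (\<Phi> x))" "continuous_on M (\<lambda>x. g2 (\<Phi> x))"
    using g \<Phi> by (auto intro: continuous_on_compose2)
  note mono = quasi_state_mono[OF \<zeta> M(1)]
  have near: "\<bar>g1 (\<Phi> x) - p1 (\<Phi> x)\<bar> < e / 4" "\<bar>g2 (\<Phi> x) - p2 (\<Phi> x)\<bar> < e / 4" if "x \<in> M" for x
    using p1(2) p2(2) that by blast+
  have "\<zeta> (\<lambda>x. g1 (\<Phi> x) + g2 (\<Phi> x)) \<le> \<zeta> (\<lambda>x. p1 (\<Phi> x) + p2 (\<Phi> x)) + e / 2"
    proof (intro mono continuous_on_add cp cg)
    show "g1 (\<Phi> x) + g2 (\<Phi> x) \<le> p1 (\<Phi> x) + p2 (\<Phi> x) + e / 2" if "x \<in> M" for x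
      using near[OF that] by linarith
  qed
  moreover have "\<zeta> (\<lambda>x. p1 (\<Phi> x)) \<le> \<zeta> (\<lambda>x. g1 (\<Phi> x)) + e / 4"
  proof (intro mono cp cg)
    show "p1 (\<Phi> x) \<le> g1 (\<Phi> x) + e / 4" if "x \<in> M" for x
      using near(1)[OF that] by linarith
  qed
  moreover have "\<zeta> (\<lambda>x. p2 (\<Phi> x)) \<le> \<zeta> (\<lambda>x. g2 (\<Phi> x)) + e / 4"
  proof (intro mono cp cg)
    show "p2 (\<Phi> x) \<le> g2 (\<Phi> x) + e / 4" if "x \<in> M" for x
      using near(2)[OF that] by linarith
  qed
  ultimately show "\<zeta> (\<lambda>x. g1 (A x, B x) + g2 (A x, B x)) \<le>
      \<zeta> (\<lambda>x. g1 (A x, B x)) + \<zeta> (\<lambda>x. g2 (A x, B x)) + e"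
    using sub unfolding \<Phi>_def by linarith
qed

lemma compact_positive_lower_bound:
  fixes h :: "'a::topological_space \<Rightarrow> real"
  assumes "compact C" "continuous_on C h" "\<And>x. x \<in> C \<Longrightarrow> h x > 0"
  obtains d where "d > 0" "\<And>x. x \<in> C \<Longrightarrow> d \<le> h x"
proof (cases "C = {}")
  case True
  then show ?thesis using that[of 1] by simp
next
  case False
  then obtain x where "x \<in> C" "\<And>y. y \<in> C \<Longrightarrow> h x \<le> h y"
    using continuous_attains_inf[OF assms(1) _ assms(2)] by blast
  then show ?thesis using that[of "h x"] assms(3) by simp
qed

text \<open>
  Bounding \<open>\<zeta> G\<close> by each real \<open>c\<close> that lies strictly above \<open>G\<close> on \<open>X\<close> avoids the extended reals and the
  case of empty \<open>X\<close>.
\<close>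

lemma superheavyI:
  assumes "closedin (top_of_set M) X"
    and "\<And>G c. continuous_on M G \<Longrightarrow> (\<And>x. x \<in> X \<Longrightarrow> G x < c) \<Longrightarrow> \<zeta> G \<le> c"
  shows "superheavy M \<zeta> X"
  unfolding superheavy_def
proof (intro conjI ballI)
  fix G assume "G \<in> continuous_functions M"
  then have G: "continuous_on M G" by (simp add: continuous_functions_def)
  show "ereal (\<zeta> G) \<le> (SUP x\<in>X. ereal (G x))"
  proof (rule ccontr)
    assume "\<not> ereal (\<zeta> G) \<le> (SUP x\<in>X. ereal (G x))"
    then obtain c where c: "(SUP x\<in>X. ereal (G x)) < ereal c" "ereal c < ereal (\<zeta> G)"
      using ereal_dense2[of "SUP x\<in>X. ereal (G x)" "ereal (\<zeta> G)"] by (auto simp: not_le)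
    have "G x < c" if "x \<in> X" for x
      using SUP_upper[of x X "\<lambda>x. ereal (G x)"] c(1) that by (metis ereal_less(2) le_less_trans less_ereal.simps(1))
    then show False
      using assms(2)[OF G, of c] c(2) by simp
  qed
qed fact

text \<open>
  The thresholds: \<open>\<delta>\<close> is such that \<open>G < c\<close> where \<open>\<bar>J\<bar>\<close> and \<open>\<bar>H\<bar>\<close> are below \<open>\<delta>\<close>; then \<open>\<eta>\<close> is so small
  that for \<open>\<bar>J\<bar> \<le> 2 * \<eta>\<close> the half turns still change the sign of \<open>H\<close> where \<open>\<bar>H\<bar> \<ge> \<delta> / 2\<close>. The second
  choice is possible by compactness, since on \<open>J = 0\<close> the half turns negate \<open>H\<close>.
\<close>

lemma superheavy_fiber_Phi:
  assumes R: "R > 0" and f: "smooth_on ({-1..1} \<times> {-1..1}) f"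
    and F: "\<forall>z\<in>{-1..1}. \<bar>R * z\<bar> \<le> 1 \<longrightarrow> F_fun R f z = 0"
    and \<zeta>: "partial_symplectic_quasi_state (S2 \<times> S2) (omega R) \<zeta>"
  shows "superheavy (S2 \<times> S2) \<zeta> (fiber (S2 \<times> S2) (Phi R f) (0, 0))"
proof (rule superheavyI)
  show "closedin (top_of_set (S2 \<times> S2)) (fiber (S2 \<times> S2) (Phi R f) (0, 0))"
    by (intro closed_subset closed_fiber continuous_on_Phi f closed_Times closed_sphere)
       (auto simp: fiber_def)
next
  let ?M = "S2 \<times> S2 :: ((real^3) \<times> (real^3)) set"
  let ?J = "J_fun R" and ?H = "H_fun f"
  fix G and c :: real
  assume G: "continuous_on ?M G" and GX: "\<And>x. x \<in> fiber ?M (Phi R f) (0, 0) \<Longrightarrow> G x < c"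
  have M: "compact ?M" "?M \<noteq> {}"
    using origin_in_Phi_image[OF F] by (auto simp: compact_Times fiber_def)
  then have "closed ?M" by (simp add: compact_imp_closed)
  note J = smooth_on_imp_continuous_on[OF smooth_on_J_fun[of ?M R]]
  note H = smooth_on_imp_continuous_on[OF smooth_on_H_fun[OF f]]
  have H': "continuous_on ?M (\<lambda>x. ?H (half_turns x))"
    by (rule continuous_on_compose2[OF H continuous_on_half_turns]) (use half_turns_in_S2_S2 in blast)
  have compact_sub: "compact {x \<in> ?M. a x \<le> (b x :: real)}"
    if "continuous_on ?M a" "continuous_on ?M b" for a b
  proof -
    have "closed {x \<in> ?M. a x \<le> b x}"
      by (rule continuous_on_closed_Collect_le[OF that \<open>closed ?M\<close>])
    then have "compact (?M \<inter> {x \<in> ?M. a x \<le> b x})"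
      using M(1) by (rule compact_Int_closed[rotated])
    moreover have "?M \<inter> {x \<in> ?M. a x \<le> b x} = {x \<in> ?M. a x \<le> b x}"
      by blast
    ultimately show ?thesis by metis
  qed
  obtain \<delta> where \<delta>: "\<delta> > 0" "\<And>x. x \<in> ?M \<Longrightarrow> c \<le> G x \<Longrightarrow> \<delta> \<le> max \<bar>?J x\<bar> \<bar>?H x\<bar>"
  proof (rule compact_positive_lower_bound)
    show "compact {x \<in> ?M. c \<le> G x}"
      by (intro compact_sub G continuous_on_const)
    show "continuous_on {x \<in> ?M. c \<le> G x} (\<lambda>x. max \<bar>?J x\<bar> \<bar>?H x\<bar>)"
      by (intro continuous_on_max continuous_on_rabs continuous_on_subset[OF J] continuous_on_subset[OF H]) auto
    show "max \<bar>?J x\<bar> \<bar>?H x\<bar> > 0" if "x \<in> {x \<in> ?M. c \<le> G x}" for x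
      using GX[of x] that by (auto simp: fiber_def Phi_def less_max_iff_disj)
  qed auto
  obtain m where m: "m > 0"
    "\<And>x. x \<in> ?M \<Longrightarrow> \<delta> / 2 \<le> \<bar>?H x\<bar> \<Longrightarrow> 0 \<le> ?H x * ?H (half_turns x) \<Longrightarrow> m \<le> \<bar>?J x\<bar>"
  proof (rule compact_positive_lower_bound)
    let ?C = "{x \<in> ?M. \<delta> / 2 \<le> \<bar>?H x\<bar>} \<inter> {x \<in> ?M. 0 \<le> ?H x * ?H (half_turns x)}"
    show "compact ?C"
      by (intro compact_Int compact_sub continuous_intros H H')
    show "continuous_on ?C (\<lambda>x. \<bar>?J x\<bar>)"
      by (intro continuous_on_rabs continuous_on_subset[OF J]) auto
    show "\<bar>?J x\<bar> > 0" if "x \<in> ?C" for x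
    proof (rule ccontr)
      assume "\<not> \<bar>?J x\<bar> > 0"
      then have "?H (half_turns x) = - ?H x"
        using that by (intro H_fun_half_turns[OF F]) auto
      then show False
        using that \<delta>(1) by (auto simp: zero_le_mult_iff)
    qed
  qed auto
  define \<eta> where "\<eta> = min \<delta> (m / 3)"
  have \<eta>: "\<eta> > 0" "\<eta> \<le> \<delta>" "2 * \<eta> < m"
    using \<delta>(1) m(1) by (auto simp: \<eta>_def)
  have "bounded ((\<lambda>x. G x - c) ` ?M)"
    by (intro compact_imp_bounded compact_continuous_image M continuous_intros G)
  then obtain K where K: "K > 0" "\<And>x. x \<in> ?M \<Longrightarrow> \<bar>G x - c\<bar> \<le> K"
    by (auto simp: bounded_pos)
  \<comment> \<open>Cut-offs with \<open>\<sigma> = 1\<close> or \<open>\<sigma> = -1\<close>: \<open>a \<sigma>\<close> is at least \<open>K\<close> where \<open>\<sigma> J \<ge> \<eta>\<close> and vanishes where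
    \<open>\<sigma> J \<le> \<eta> / 2\<close>; \<open>b \<sigma>\<close> is at least \<open>K\<close> where \<open>\<sigma> H \<ge> \<delta>\<close>, \<open>\<bar>J\<bar> \<le> \<eta>\<close>, and vanishes where
    \<open>\<sigma> H \<le> \<delta> / 2\<close> or \<open>\<bar>J\<bar> \<ge> 2 * \<eta>\<close>.\<close>
  define a where "a \<sigma> y = K * max 0 (2 * \<sigma> * fst y / \<eta> - 1)" for \<sigma> and y :: "real \<times> real"
  define b where "b \<sigma> y = K * max 0 (2 * \<sigma> * snd y / \<delta> - 1) * max 0 (2 - \<bar>fst y\<bar> / \<eta>)"
    for \<sigma> and y :: "real \<times> real"
  have ca: "continuous_on S (a \<sigma>)" and cb: "continuous_on S (b \<sigma>)" for \<sigma> S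
    unfolding a_def b_def using \<delta>(1) \<eta>(1) by (auto intro!: continuous_intros)
  have cphi: "continuous_on ?M (\<lambda>x. g (?J x, ?H x))" if "continuous_on UNIV g" for g :: "real \<times> real \<Rightarrow> real"
    by (rule continuous_on_compose2[OF that continuous_on_Pair[OF J H]]) auto
  have closed_sub: "closed {x \<in> ?M. u x \<le> (v x :: real)}"
    if "continuous_on ?M u" "continuous_on ?M v" for u v
    using compact_sub[OF that] by (rule compact_imp_closed)
  have va: "\<zeta> (\<lambda>x. a \<sigma> (?J x, ?H x)) = 0" for \<sigma>
  proof (rule quasi_state_vanishes[OF \<zeta> cphi[OF ca] half_turns_Ham[OF R]])
    let ?D = "{x \<in> ?M. \<eta> / 2 \<le> \<sigma> * ?J x}"
    show "closed ?D"
      by (intro closed_sub continuous_intros J)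
    show "{x \<in> ?M. a \<sigma> (?J x, ?H x) \<noteq> 0} \<subseteq> ?D"
      using \<eta>(1) by (auto simp: a_def field_simps max_def split: if_splits)
    show "half_turns x \<notin> ?D" if "x \<in> ?M \<inter> ?D" for x
      using that \<eta>(1) by (auto simp: J_fun_half_turns)
  qed
  have vb: "\<zeta> (\<lambda>x. b \<sigma> (?J x, ?H x)) = 0" if \<sigma>: "\<bar>\<sigma>\<bar> = 1" for \<sigma>
  proof (rule quasi_state_vanishes[OF \<zeta> cphi[OF cb] half_turns_Ham[OF R]])
    let ?D = "{x \<in> ?M. \<delta> / 2 \<le> \<sigma> * ?H x} \<inter> {x \<in> ?M. \<bar>?J x\<bar> \<le> 2 * \<eta>}"
    show "closed ?D"
      by (intro closed_Int closed_sub continuous_intros J H)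
    show "{x \<in> ?M. b \<sigma> (?J x, ?H x) \<noteq> 0} \<subseteq> ?D"
      using \<eta>(1) \<delta>(1) by (auto simp: b_def field_simps max_def split: if_splits)
    show "half_turns x \<notin> ?D" if "x \<in> ?M \<inter> ?D" for x
    proof
      assume "half_turns x \<in> ?D"
      with that have x: "x \<in> ?M" "\<delta> / 2 \<le> \<sigma> * ?H x" "\<delta> / 2 \<le> \<sigma> * ?H (half_turns x)" "\<bar>?J x\<bar> \<le> 2 * \<eta>"
        by auto
      have "\<sigma> = 1 \<or> \<sigma> = -1" using \<sigma> by linarith
      then have "\<delta> / 2 \<le> \<bar>?H x\<bar>" "0 \<le> ?H x * ?H (half_turns x)"
        using x(2,3) \<delta>(1) by (auto simp: zero_le_mult_iff)
      then show False
        using m(2)[OF x(1)] x(4) \<eta>(3) by linarith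
    qed
  qed
  have sub: "\<zeta> (\<lambda>x. g1 (?J x, ?H x) + g2 (?J x, ?H x)) \<le> \<zeta> (\<lambda>x. g1 (?J x, ?H x)) + \<zeta> (\<lambda>x. g2 (?J x, ?H x))"
    if "continuous_on UNIV g1" "continuous_on UNIV g2" for g1 g2 :: "real \<times> real \<Rightarrow> real"
    using quasi_state_subadditive_joint[OF \<zeta> M(2,1) smooth_on_J_fun smooth_on_H_fun[OF f]
        J_H_dependent_commute[OF R f] that] .
  \<comment> \<open>The majorant of \<open>G\<close>: off the set where both \<open>\<bar>J\<bar>\<close> and \<open>\<bar>H\<bar>\<close> are small, one of the four
    cut-offs contributes at least \<open>K\<close>.\<close>
  define u where "u y = c + (a 1 y + (a (-1) y + (b 1 y + b (-1) y)))" for y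
  have nonneg: "0 \<le> a \<sigma> y" "0 \<le> b \<sigma> y" for \<sigma> y
    using K(1) by (simp_all add: a_def b_def)
  have a_ge: "K \<le> a \<sigma> (s, t)" if "\<eta> \<le> \<sigma> * s" for \<sigma> s t
  proof -
    have "1 \<le> 2 * \<sigma> * s / \<eta> - 1"
      using that \<eta>(1) by (simp add: field_simps)
    then have "K * 1 \<le> K * max 0 (2 * \<sigma> * s / \<eta> - 1)"
      using K(1) by (intro mult_left_mono) auto
    then show ?thesis by (simp add: a_def)
  qed
  have b_ge: "K \<le> b \<sigma> (s, t)" if "\<delta> \<le> \<sigma> * t" "\<bar>s\<bar> \<le> \<eta>" for \<sigma> s t
  proof -
    have "1 \<le> 2 * \<sigma> * t / \<delta> - 1" "1 \<le> 2 - \<bar>s\<bar> / \<eta>"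
      using that \<eta>(1) \<delta>(1) by (simp_all add: field_simps)
    then have "K * 1 * 1 \<le> K * max 0 (2 * \<sigma> * t / \<delta> - 1) * max 0 (2 - \<bar>s\<bar> / \<eta>)"
      using K(1) by (intro mult_mono mult_left_mono) auto
    then show ?thesis by (simp add: b_def)
  qed
  have "\<zeta> G \<le> \<zeta> (\<lambda>x. u (?J x, ?H x)) + 0"
  proof (rule quasi_state_mono[OF \<zeta> M(2) G cphi])
    show "continuous_on UNIV u"
      unfolding u_def by (intro continuous_intros ca cb)
    fix x assume x: "x \<in> ?M"
    show "G x \<le> u (?J x, ?H x) + 0"
    proof (cases "c \<le> G x")
      case True
      then consider "\<eta> \<le> 1 * ?J x" | "\<eta> \<le> -1 * ?J x" | "\<delta> \<le> 1 * ?H x" "\<bar>?J x\<bar> \<le> \<eta>"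
        | "\<delta> \<le> -1 * ?H x" "\<bar>?J x\<bar> \<le> \<eta>"
        using \<delta>(2)[OF x] \<eta>(2) by linarith
      then have "K \<le> a 1 (?J x, ?H x) + (a (-1) (?J x, ?H x) + (b 1 (?J x, ?H x) + b (-1) (?J x, ?H x)))"
      proof cases
        case 1
        then show ?thesis using a_ge[OF 1] nonneg by (intro add_increasing2 add_nonneg_nonneg) auto
      next
        case 2
        then show ?thesis
          using a_ge[OF 2] nonneg by (intro add_increasing add_increasing2[of "b 1 _ + _"] add_nonneg_nonneg) auto
      next
        case 3
        then show ?thesis
          using b_ge[OF 3] nonneg by (intro add_increasing add_increasing2[of "b (-1) _"]) auto
      next
        case 4
        then show ?thesis
          using b_ge[OF 4] nonneg by (intro add_increasing) auto
      qed
      then show ?thesis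
        using K(2)[OF x] by (simp add: u_def)
    next
      case False
      then show ?thesis
        using nonneg[of _ "(?J x, ?H x)"] by (simp add: u_def add_increasing2 order.trans[of "G x" c])
    qed
  qed
  also have "\<dots> \<le> \<zeta> (\<lambda>_. c)"
  proof -
    have "\<zeta> (\<lambda>x. u (?J x, ?H x)) \<le> \<zeta> (\<lambda>_. c) +
        \<zeta> (\<lambda>x. a 1 (?J x, ?H x) + (a (-1) (?J x, ?H x) + (b 1 (?J x, ?H x) + b (-1) (?J x, ?H x))))"
      unfolding u_def
      using sub[of "\<lambda>_. c" "\<lambda>y. a 1 y + (a (-1) y + (b 1 y + b (-1) y))"]
      by (simp add: continuous_on_add ca cb)
    moreover have "\<zeta> (\<lambda>x. a 1 (?J x, ?H x) + (a (-1) (?J x, ?H x) + (b 1 (?J x, ?H x) + b (-1) (?J x, ?H x))))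
        \<le> \<zeta> (\<lambda>x. a (-1) (?J x, ?H x) + (b 1 (?J x, ?H x) + b (-1) (?J x, ?H x)))"
      using sub[of "a 1" "\<lambda>y. a (-1) y + (b 1 y + b (-1) y)"] va
      by (simp add: continuous_on_add ca cb)
    moreover have "\<zeta> (\<lambda>x. a (-1) (?J x, ?H x) + (b 1 (?J x, ?H x) + b (-1) (?J x, ?H x)))
        \<le> \<zeta> (\<lambda>x. b 1 (?J x, ?H x) + b (-1) (?J x, ?H x))"
      using sub[of "a (-1)" "\<lambda>y. b 1 y + b (-1) y"] va
      by (simp add: continuous_on_add ca cb)
    moreover have "\<zeta> (\<lambda>x. b 1 (?J x, ?H x) + b (-1) (?J x, ?H x)) \<le> 0"
      using sub[of "b 1" "b (-1)"] vb by (simp add: ca cb)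
    ultimately show ?thesis by linarith
  qed
  also have "\<zeta> (\<lambda>_. c) = c"
    using \<zeta> unfolding partial_symplectic_quasi_state_def by blast
  finally show "\<zeta> G \<le> c" .
qed

theorem theorem5p2:
  fixes R :: real and f :: "real \<times> real \<Rightarrow> real"
  assumes "R > 0"
    and "smooth_on ({-1..1} \<times> {-1..1}) f"
    and "\<forall>z\<in>{-1..1}. \<bar>R * z\<bar> \<le> 1 \<longrightarrow> F_fun R f z = 0"
  shows "stem (S2 \<times> S2) (omega R) (fiber (S2 \<times> S2) (Phi R f) (0, 0)) \<and>
         (\<forall>\<zeta>. partial_symplectic_quasi_state (S2 \<times> S2) (omega R) \<zeta> \<longrightarrow>
              superheavy (S2 \<times> S2) \<zeta> (fiber (S2 \<times> S2) (Phi R f) (0, 0)))"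
  using stem_fiber_Phi[OF assms] superheavy_fiber_Phi[OF assms] by blast

end
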